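(* Let $K$ be an infinite field of arbitrary characteristic and let $n\ge 4$. Then there are no multilinear power-central polynomials for $M_n(K)$. Moreover, for any multilinear polynomial $p\in K\langle x_1,\dots,x_m\rangle$, either $p$ is PI, or $p$ is central, or its image in $M_n(K)$ is at least $(n^2-n+2)$-dimensional.
   Context: $K\langle x_1,\dots,x_m\rangle$ is the free associative algebra in noncommuting variables, and polynomials are evaluated on $M_n(K)$. A polynomial is multilinear if it is a $K$-linear combination of monomials $x_{\pi(1)}\cdots x_{\pi(m)}$ with $\pi\in S_m$. A polynomial is PI if it vanishes identically on $M_n(K)$. It is central if it takes on only scalar values on $M_n(K)$ but does not vanish identically. It is $\nu$-central if $p^\nu$ is central, with $\nu\ge 1$ minimal such. It is power-central if it is $\nu$-central for some $\nu>1$. The image of $p$ is $\{p(a_1,\dots,a_m): a_1,\dots,a_m\in M_n(K)\}$, and its dimension is the dimension of its Zariski closure in $M_n(K)$, viewed as affine $n^2$-space. *)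

theory Defs
  imports
    "HOL-Analysis.Finite_Cartesian_Product"
    "HOL-Library.Poly_Mapping"
    "HOL-Library.Extended_Nat"
    "HOL-Combinatorics.Permutations"
    "HOL-Algebra.QuotRing"
    "HOL-Algebra.Algebraic_Closure_Type"
begin

text \<open>
  The free associative algebra is the monoid algebra of the free monoid.  Words are wrapped in a
  datatype of their own so that concatenation can be their \<open>monoid_add\<close> structure; the
  convolution product of \<open>poly_mapping\<close> is then the noncommutative product.
\<close>

datatype 'v ncword = NCWord (letters: "'v list")

instantiation ncword :: (type) monoid_add
begin

definition zero_ncword :: "'v ncword" where
  "zero_ncword = NCWord []"

definition plus_ncword :: "'v ncword \<Rightarrow> 'v ncword \<Rightarrow> 'v ncword" where
  "plus_ncword u w = NCWord (letters u @ letters w)"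

instance
  by standard (simp_all add: zero_ncword_def plus_ncword_def)

end

type_synonym ('v, 'k) free_algebra = "'v ncword \<Rightarrow>\<^sub>0 'k"

definition word_eval :: "('v \<Rightarrow> 'k::field^'n::finite^'n) \<Rightarrow> 'v ncword \<Rightarrow> 'k^'n^'n" where
  "word_eval a w = foldr (\<lambda>v M. a v ** M) (letters w) (mat 1)"

definition nc_eval :: "('v \<Rightarrow> 'k::field^'n::finite^'n) \<Rightarrow> ('v, 'k) free_algebra \<Rightarrow> 'k^'n^'n" where
  "nc_eval a p = (\<Sum>w\<in>Poly_Mapping.keys p. mat (Poly_Mapping.lookup p w) ** word_eval a w)"

text \<open>
  The variables \<open>x\<^sub>1, x\<^sub>2, \<dots>\<close> are the natural numbers \<open>1, 2, \<dots>\<close>; a multilinear polynomial in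
  \<open>m\<close> variables involves only \<open>1, \<dots>, m\<close>, so the values of an assignment elsewhere are irrelevant.
\<close>

definition multilinear :: "nat \<Rightarrow> (nat, 'k::field) free_algebra \<Rightarrow> bool" where
  "multilinear m p \<longleftrightarrow>
    (\<exists>c. p = (\<Sum>\<pi> | \<pi> permutes {1..m}.
                Poly_Mapping.single (NCWord (map \<pi> [1..<Suc m])) (c \<pi>)))"

text \<open>
  The argument of type \<open>'n itself\<close> selects the matrix algebra; its size is \<open>CARD('n)\<close>.
\<close>

definition PI_poly :: "'n::finite itself \<Rightarrow> ('v, 'k::field) free_algebra \<Rightarrow> bool" where
  "PI_poly _ p \<longleftrightarrow> (\<forall>a :: 'v \<Rightarrow> 'k^'n^'n. nc_eval a p = 0)"

definition central_poly :: "'n::finite itself \<Rightarrow> ('v, 'k::field) free_algebra \<Rightarrow> bool" where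
  "central_poly N p \<longleftrightarrow>
    (\<forall>a :: 'v \<Rightarrow> 'k^'n^'n. \<exists>c. nc_eval a p = mat c) \<and> \<not> PI_poly N p"

definition nu_central :: "'n::finite itself \<Rightarrow> nat \<Rightarrow> ('v, 'k::field) free_algebra \<Rightarrow> bool" where
  "nu_central N \<nu> p \<longleftrightarrow>
    \<nu> \<ge> 1 \<and> central_poly N (p ^ \<nu>) \<and> (\<forall>\<mu>. 1 \<le> \<mu> \<and> \<mu> < \<nu> \<longrightarrow> \<not> central_poly N (p ^ \<mu>))"

definition power_central :: "'n::finite itself \<Rightarrow> ('v, 'k::field) free_algebra \<Rightarrow> bool" where
  "power_central N p \<longleftrightarrow> (\<exists>\<nu>>1. nu_central N \<nu> p)"

definition poly_image :: "('v, 'k::field) free_algebra \<Rightarrow> ('k^'n::finite^'n) set" where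
  "poly_image p = {nc_eval a p | a. True}"

text \<open>
  Polynomial functions on matrices, viewed as affine space with one coordinate for each entry.
\<close>

type_synonym ('n, 'k) entry_poly = "('n \<times> 'n \<Rightarrow>\<^sub>0 nat) \<Rightarrow>\<^sub>0 'k"

definition entry_eval :: "'k::field^'n::finite^'n \<Rightarrow> ('n, 'k) entry_poly \<Rightarrow> 'k" where
  "entry_eval A f =
    (\<Sum>t\<in>Poly_Mapping.keys f. Poly_Mapping.lookup f t *
      (\<Prod>(i, j)\<in>UNIV. (A $ i $ j) ^ Poly_Mapping.lookup t (i, j)))"

definition zariski_closed :: "('k::field^'n::finite^'n) set \<Rightarrow> bool" where
  "zariski_closed V \<longleftrightarrow> (\<exists>F. V = {A. \<forall>f\<in>F. entry_eval A f = 0})"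

definition zariski_closure :: "('k::field^'n::finite^'n) set \<Rightarrow> ('k^'n^'n) set" where
  "zariski_closure S = zariski_closed hull S"

definition vanishing_ideal :: "('k::field^'n::finite^'n) set \<Rightarrow> ('n, 'k) entry_poly set" where
  "vanishing_ideal V = {f. \<forall>A\<in>V. entry_eval A f = 0}"

definition krull_dim :: "('a, 'b) ring_scheme \<Rightarrow> enat" where
  "krull_dim R = Sup {enat k | k.
    \<exists>P :: nat \<Rightarrow> 'a set. (\<forall>i\<le>k. primeideal (P i) R) \<and> (\<forall>i<k. P i \<subset> P (Suc i))}"

text \<open>
  The dimension of a Zariski closed set is the Krull dimension of its coordinate ring.  Chains of
  irreducible closed sets of rational points would not do: over a field that is not algebraically
  closed they can be too short.
\<close>

definition variety_dim :: "('k::field^'n::finite^'n) set \<Rightarrow> enat" where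
  "variety_dim V =
    krull_dim ((ring_of_type_algebra :: ('n, 'k) entry_poly ring) Quot vanishing_ideal V)"

definition image_dim :: "'n::finite itself \<Rightarrow> ('v, 'k::field) free_algebra \<Rightarrow> enat" where
  "image_dim _ p = variety_dim (zariski_closure (poly_image p :: ('k^'n^'n) set))"

end

theory Submission
  imports Defs "HOL-Analysis.Determinants"
begin

text \<open>
  Let \<open>P\<close> be the evaluation map of a multilinear polynomial, and suppose that \<open>P\<^sup>\<nu>\<close> takes scalar values
  only.  If some value of \<open>P\<close> is not scalar, then by conjugation some value has a nonconstant
  diagonal, and by multilinearity this happens already at matrix units, where the value \<open>D\<close> is a
  diagonal matrix.  Number the indices by the residues modulo \<open>n\<close> in any way and grade the matrix
  algebra by \<open>deg e\<^sub>i\<^sub>j = j - i\<close>.  On the assignments with the same degrees, \<open>P\<close> is diagonal, and the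
  quotients of its diagonal entries are roots of unity, hence constant.  Shifting all indices by 1
  keeps the degrees, so \<open>D\<close> is a geometric progression in every cyclic ordering of the indices.  For
  \<open>n \<ge> 4\<close> this forces \<open>D\<close> to be scalar.

  For the dimension, the same grading yields a value \<open>C\<close> of \<open>P\<close> that is a weighted \<open>n\<close>-cycle.  The
  image contains all \<open>s g C g\<^sup>-\<^sup>1\<close>, whose \<open>n\<close>-th powers are scalar, and by the first part it contains
  other matrices as well.  Primes come from rationally connected families of matrices: the image,
  the matrices \<open>s g C g\<^sup>-\<^sup>1\<close>, and the \<open>g C g\<^sup>-\<^sup>1\<close> with more and more entries of \<open>g\<close> prescribed.
\<close>

section \<open>Functions that are polynomial along lines\<close>

definition polyfn :: "('k::field \<Rightarrow> 'k) \<Rightarrow> bool" where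
  "polyfn h \<longleftrightarrow> (\<exists>q. \<forall>s. h s = poly q s)"

lemma polyfn_const [simp, intro]: "polyfn (\<lambda>s. c)"
  unfolding polyfn_def by (rule exI[of _ "[:c:]"]) simp

lemma polyfn_ident [simp, intro]: "polyfn (\<lambda>s. s)"
  unfolding polyfn_def by (rule exI[of _ "[:0, 1:]"]) simp

lemma polyfn_add [intro]: "polyfn f \<Longrightarrow> polyfn g \<Longrightarrow> polyfn (\<lambda>s. f s + g s)"
  unfolding polyfn_def by (metis poly_add)

lemma polyfn_mult [intro]: "polyfn f \<Longrightarrow> polyfn g \<Longrightarrow> polyfn (\<lambda>s. f s * g s)"
  unfolding polyfn_def by (metis poly_mult)

lemma polyfn_diff [intro]: "polyfn f \<Longrightarrow> polyfn g \<Longrightarrow> polyfn (\<lambda>s. f s - g s)"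
  unfolding polyfn_def by (metis poly_diff)

lemma polyfn_power [intro]: "polyfn f \<Longrightarrow> polyfn (\<lambda>s. f s ^ N)"
  unfolding polyfn_def by (metis poly_power)

lemma polyfn_sum [intro]: "(\<And>i. i \<in> A \<Longrightarrow> polyfn (f i)) \<Longrightarrow> polyfn (\<lambda>s. \<Sum>i\<in>A. f i s)"
  by (induction A rule: infinite_finite_induct) auto

lemma polyfn_prod [intro]: "(\<And>i. i \<in> A \<Longrightarrow> polyfn (f i)) \<Longrightarrow> polyfn (\<lambda>s. \<Prod>i\<in>A. f i s)"
  by (induction A rule: infinite_finite_induct) auto

text \<open>The product of the two polynomials is nonzero, so it has only finitely many roots. The
  genericity arguments below reduce to this one-variable case.\<close>

lemma polyfn_common_nonzero:
  fixes f g :: "'k::field \<Rightarrow> 'k"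
  assumes inf: "infinite (UNIV :: 'k set)"
    and "polyfn f" "f a \<noteq> 0" "polyfn g" "g b \<noteq> 0"
  shows "\<exists>s. f s \<noteq> 0 \<and> g s \<noteq> 0"
proof -
  obtain q r where q: "\<And>s. f s = poly q s" and r: "\<And>s. g s = poly r s"
    using assms unfolding polyfn_def by blast
  have "q * r \<noteq> 0"
    using q r assms(3,5) by auto
  then have "finite {s. poly (q * r) s = 0}"
    by (rule poly_roots_finite)
  then obtain s where "poly (q * r) s \<noteq> 0"
    using inf by (metis (mono_tags, lifting) UNIV_eq_I mem_Collect_eq)
  then show ?thesis
    by (auto simp: q r)
qed

section \<open>Lines in the space of assignments and genericity along them\<close>

definition mscale :: "'k::field \<Rightarrow> 'k^'n^'n \<Rightarrow> 'k^'n^'n" where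
  "mscale c A = (\<chi> i j. c * A $ i $ j)"

lemma mscale_nth [simp]: "mscale c A $ i $ j = c * A $ i $ j"
  by (simp add: mscale_def)

lemma mscale_0 [simp]: "mscale 0 A = 0" "mscale c 0 = 0"
  by (simp_all add: vec_eq_iff)

lemma mscale_1 [simp]: "mscale 1 A = A"
  by (simp add: vec_eq_iff)

definition line :: "(nat \<Rightarrow> 'k::field^'n^'n) \<Rightarrow> (nat \<Rightarrow> 'k^'n^'n) \<Rightarrow> 'k \<Rightarrow> nat \<Rightarrow> 'k^'n^'n" where
  "line y z s = (\<lambda>k. y k + mscale s (z k - y k))"

lemma line_0 [simp]: "line y z 0 = y" and line_1 [simp]: "line y z 1 = z"
  by (auto simp: line_def)

text \<open>Asking for polynomials along lines only keeps everything in one variable. Any two points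
  lie on a line, and genericity needs no more than that.\<close>

definition line_poly :: "((nat \<Rightarrow> 'k::field^'n^'n) \<Rightarrow> 'k) \<Rightarrow> bool" where
  "line_poly f \<longleftrightarrow> (\<forall>y z. polyfn (\<lambda>s. f (line y z s)))"

lemma line_poly_const [simp, intro]: "line_poly (\<lambda>y. c)"
  by (simp add: line_poly_def)

lemma line_poly_mult [intro]: "line_poly f \<Longrightarrow> line_poly g \<Longrightarrow> line_poly (\<lambda>y. f y * g y)"
  by (auto simp: line_poly_def)

lemma line_poly_diff [intro]: "line_poly f \<Longrightarrow> line_poly g \<Longrightarrow> line_poly (\<lambda>y. f y - g y)"
  by (auto simp: line_poly_def)

lemma line_poly_prod [intro]:
  "(\<And>i. i \<in> A \<Longrightarrow> line_poly (f i)) \<Longrightarrow> line_poly (\<lambda>y. \<Prod>i\<in>A. f i y)"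
  by (auto simp: line_poly_def)

definition line_closed :: "(nat \<Rightarrow> 'k::field^'n^'n) set \<Rightarrow> bool" where
  "line_closed A \<longleftrightarrow> (\<forall>y\<in>A. \<forall>z\<in>A. \<forall>s. line y z s \<in> A)"

lemma line_poly_common_nonzero:
  fixes f g :: "(nat \<Rightarrow> 'k::field^'n::finite^'n) \<Rightarrow> 'k"
  assumes inf: "infinite (UNIV :: 'k set)" and A: "line_closed A"
    and "line_poly f" "y \<in> A" "f y \<noteq> 0" "line_poly g" "z \<in> A" "g z \<noteq> 0"
  shows "\<exists>x\<in>A. f x \<noteq> 0 \<and> g x \<noteq> 0"
proof -
  have "\<exists>s. f (line y z s) \<noteq> 0 \<and> g (line y z s) \<noteq> 0"
    using assms by (intro polyfn_common_nonzero[OF inf, where a = 0 and b = 1])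
      (auto simp: line_poly_def)
  then show ?thesis
    using A assms(4,7) by (auto simp: line_closed_def)
qed

text \<open>Induction: a point that serves for \<open>S\<close> and one that serves for
  \<open>i\<close> are joined by a line, with the product over \<open>S\<close> treated as a single
  function.\<close>

lemma line_poly_common_nonzero_finite:
  fixes f :: "'i \<Rightarrow> (nat \<Rightarrow> 'k::field^'n::finite^'n) \<Rightarrow> 'k"
  assumes inf: "infinite (UNIV :: 'k set)" and A: "line_closed A" "A \<noteq> {}"
    and "finite S" "\<And>i. i \<in> S \<Longrightarrow> line_poly (f i)" "\<And>i. i \<in> S \<Longrightarrow> \<exists>y\<in>A. f i y \<noteq> 0"
  shows "\<exists>x\<in>A. \<forall>i\<in>S. f i x \<noteq> 0"
  using assms(4-)
proof (induction S)
  case empty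
  then show ?case using A by blast
next
  case (insert i S)
  then obtain x where x: "x \<in> A" "\<forall>i\<in>S. f i x \<noteq> 0"
    by (metis insertCI)
  obtain y where y: "y \<in> A" "f i y \<noteq> 0"
    using insert by blast
  have "\<exists>w\<in>A. f i w \<noteq> 0 \<and> (\<Prod>i\<in>S. f i w) \<noteq> 0"
    by (rule line_poly_common_nonzero[OF inf A(1), where y = y and z = x])
      (use insert x y in auto)
  then show ?case
    using insert(1) by auto
qed

lemma finite_roots_of_unity:
  assumes "\<nu> \<ge> 1"
  shows "finite {z :: 'k::field. z ^ \<nu> = 1}"
proof -
  let ?q = "Polynomial.monom 1 \<nu> - 1 :: 'k poly"
  have "coeff ?q \<nu> = 1"
    using assms by simp
  then have "?q \<noteq> 0"
    by (metis coeff_0 zero_neq_one)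
  then have "finite {z. poly ?q z = 0}"
    by (rule poly_roots_finite)
  then show ?thesis
    by (simp add: poly_monom)
qed

text \<open>The quotient of two such functions with equal powers takes finitely many values, so it is
  constant.\<close>

lemma line_poly_proportional:
  fixes f g :: "(nat \<Rightarrow> 'k::field^'n::finite^'n) \<Rightarrow> 'k"
  assumes inf: "infinite (UNIV :: 'k set)" and A: "line_closed A"
    and f: "line_poly f" and g: "line_poly g"
    and "\<nu> \<ge> 1" and eq: "\<And>y. y \<in> A \<Longrightarrow> f y ^ \<nu> = g y ^ \<nu>"
    and x: "x \<in> A" "g x \<noteq> 0" and z: "z \<in> A"
  shows "f z * g x = g z * f x"
proof -
  let ?R = "{\<zeta> :: 'k. \<zeta> ^ \<nu> = 1}"
  have fin: "finite ?R"
    by (rule finite_roots_of_unity[OF \<open>\<nu> \<ge> 1\<close>])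
  have lp: "line_poly (\<lambda>y. f y - \<zeta> * g y)" for \<zeta>
    by (intro line_poly_diff line_poly_mult line_poly_const f g)
  have "\<exists>\<zeta>\<in>?R. \<forall>y\<in>A. f y = \<zeta> * g y"
  proof (rule ccontr)
    \<comment> \<open>Otherwise each root of unity fails somewhere, so by genericity all of them
      fail at one point where \<open>g\<close> is nonzero. There the quotient is itself a root of
      unity.\<close>
    assume "\<not> ?thesis"
    then have "\<exists>w\<in>A. \<forall>\<zeta>\<in>?R. f w - \<zeta> * g w \<noteq> 0"
      using x lp fin
      by (intro line_poly_common_nonzero_finite[OF inf A]) auto
    then obtain w where w: "w \<in> A" "\<forall>\<zeta>\<in>?R. f w - \<zeta> * g w \<noteq> 0"
      by blast
    have "\<exists>w\<in>A. (\<Prod>\<zeta>\<in>?R. f w - \<zeta> * g w) \<noteq> 0 \<and> g w \<noteq> 0"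
      by (rule line_poly_common_nonzero[OF inf A, where y = w and z = x])
        (use w x lp g fin in auto)
    then obtain w where w: "w \<in> A" "\<forall>\<zeta>\<in>?R. f w \<noteq> \<zeta> * g w" "g w \<noteq> 0"
      using fin by auto
    have "(f w / g w) ^ \<nu> = 1"
      using eq[OF w(1)] w(3) by (simp add: power_divide)
    then show False
      using w by force
  qed
  then show ?thesis
    using x z by auto
qed

section \<open>Multilinear functions of matrices\<close>

definition munit :: "'n \<Rightarrow> 'n \<Rightarrow> 'k::field^'n^'n" where
  "munit a b = (\<chi> i j. if i = a \<and> j = b then 1 else 0)"

lemma munit_nth [simp]: "munit a b $ i $ j = (if i = a \<and> j = b then 1 else 0)"
  by (simp add: munit_def)

text \<open>Assignments are total functions on \<open>nat\<close>; the first clause restricts the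
  dependence to the variables \<open>1, ..., m\<close>. The second packs additivity and homogeneity
  into one identity.\<close>

definition mlin :: "nat \<Rightarrow> ((nat \<Rightarrow> 'k::field^'n^'n) \<Rightarrow> 'k) \<Rightarrow> bool" where
  "mlin m f \<longleftrightarrow> (\<forall>y z. (\<forall>k\<in>{1..m}. y k = z k) \<longrightarrow> f y = f z) \<and>
    (\<forall>k\<in>{1..m}. \<forall>y A B c. f (y(k := A + mscale c B)) = f (y(k := A)) + c * f (y(k := B)))"

lemma mlin_cong: "mlin m f \<Longrightarrow> (\<And>k. k \<in> {1..m} \<Longrightarrow> y k = z k) \<Longrightarrow> f y = f z"
  by (auto simp: mlin_def)

lemma mlin_upd:
  "mlin m f \<Longrightarrow> k \<in> {1..m} \<Longrightarrow> f (y(k := A + mscale c B)) = f (y(k := A)) + c * f (y(k := B))"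
  by (auto simp: mlin_def)

lemma mlin_upd_0: "mlin m f \<Longrightarrow> k \<in> {1..m} \<Longrightarrow> f (y(k := 0)) = 0"
  using mlin_upd[of m f k y 0 1 0] by (simp only: mscale_1 add_0_left mult_1_left) (metis add_cancel_right_right)

lemma mlin_upd_scale: "mlin m f \<Longrightarrow> k \<in> {1..m} \<Longrightarrow> f (y(k := mscale c B)) = c * f (y(k := B))"
  using mlin_upd[of m f k y 0 c B] by (simp add: mlin_upd_0)

lemma mlin_upd_sum:
  assumes "mlin m f" "k \<in> {1..m}" "finite W"
  shows "f (y(k := (\<Sum>i\<in>W. mscale (c i) (B i)))) = (\<Sum>i\<in>W. c i * f (y(k := B i)))"
  using \<open>finite W\<close>
proof induction
  case (insert i W)
  have "f (y(k := (\<Sum>i\<in>W. mscale (c i) (B i)) + mscale (c i) (B i)))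
      = f (y(k := (\<Sum>i\<in>W. mscale (c i) (B i)))) + c i * f (y(k := B i))"
    by (rule mlin_upd[OF assms(1,2)])
  then show ?case
    unfolding insert.IH sum.insert[OF insert.hyps] by (simp only: add.commute)
qed (simp only: sum.empty mlin_upd_0[OF assms(1,2)])

lemma mlin_diff: "mlin m f \<Longrightarrow> mlin m g \<Longrightarrow> mlin m (\<lambda>y. f y - g y)"
  unfolding mlin_def by (intro conjI allI impI ballI) (metis, simp add: algebra_simps)

lemma mlin_scale:
  assumes f: "mlin m f"
  shows "f (\<lambda>k. mscale (c k) (y k)) = (\<Prod>k\<in>{1..m}. c k) * f y"
proof -
  have "f (\<lambda>k. if k \<in> S then mscale (c k) (y k) else y k) = (\<Prod>k\<in>S. c k) * f y"
    if "S \<subseteq> {1..m}" "finite S" for S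
    using that(2,1)
  proof induction
    case (insert k S)
    let ?y = "\<lambda>k. if k \<in> S then mscale (c k) (y k) else y k"
    have "(\<lambda>i. if i \<in> insert k S then mscale (c i) (y i) else y i) = ?y(k := mscale (c k) (y k))"
      by auto
    moreover have "?y(k := y k) = ?y"
      using insert by auto
    ultimately show ?case
      using insert mlin_upd_scale[OF f, of k ?y] by simp
  qed auto
  from this[of "{1..m}"] show ?thesis
    using mlin_cong[OF f, of "\<lambda>k. if k \<in> {1..m} then mscale (c k) (y k) else y k"] by auto
qed

text \<open>Induction on the set of arguments that move along the line. The claim quantifies over
  the other arguments, since letting argument \<open>k\<close> move splits the value into two terms
  in which it is fixed at \<open>y k\<close> and at \<open>z k - y k\<close>.\<close>

lemma mlin_line_poly:
  assumes f: "mlin m f"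
  shows "line_poly f"
  unfolding line_poly_def
proof (intro allI)
  fix y z :: "nat \<Rightarrow> 'a^'b^'b"
  have "\<forall>x. polyfn (\<lambda>s. f (\<lambda>k. if k \<in> S then line y z s k else x k))"
    if "S \<subseteq> {1..m}" "finite S" for S
    using that(2,1)
  proof induction
    case (insert k S)
    show ?case
    proof
      fix x
      let ?x = "\<lambda>s A i. if i \<in> S then line y z s i else (x(k := A)) i"
      have k: "k \<in> {1..m}" "k \<notin> S"
        using insert by auto
      have upd: "?x s A = (?x s 0)(k := A)" for s A
        by (rule ext) (use k in simp)
      have upd': "(\<lambda>i. if i \<in> insert k S then line y z s i else x i)
          = (?x s 0)(k := y k + mscale s (z k - y k))" for s
        by (rule ext) (use k in \<open>simp add: line_def\<close>)
      have "f (\<lambda>i. if i \<in> insert k S then line y z s i else x i)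
          = f (?x s (y k)) + s * f (?x s (z k - y k))" for s
        unfolding upd' mlin_upd[OF f k(1)] upd[of s "y k"] upd[of s "z k - y k"] ..
      moreover have "polyfn (\<lambda>s. f (?x s A))" for A
        using insert by blast
      ultimately show "polyfn (\<lambda>s. f (\<lambda>i. if i \<in> insert k S then line y z s i else x i))"
        by (simp only:) (intro polyfn_add polyfn_mult polyfn_ident)
    qed
  qed simp
  from this[OF subset_refl, THEN spec, of "\<lambda>k. 0"]
  have "polyfn (\<lambda>s. f (\<lambda>k. if k \<in> {1..m} then line y z s k else 0))"
    by (simp only: finite_atLeastAtMost simp_thms)
  moreover have "f (\<lambda>k. if k \<in> {1..m} then line y z s k else 0) = f (line y z s)" for s
    by (rule mlin_cong[OF f]) simp
  ultimately show "polyfn (\<lambda>s. f (line y z s))"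
    by simp
qed

definition units :: "(nat \<Rightarrow> 'n) \<Rightarrow> (nat \<Rightarrow> 'n) \<Rightarrow> nat \<Rightarrow> 'k::field^'n^'n" where
  "units I J = (\<lambda>k. munit (I k) (J k))"

lemma munit_sum: "(A :: 'k::field^'n::finite^'n) = (\<Sum>(i, j)\<in>UNIV. mscale (A $ i $ j) (munit i j))"
proof -
  have "(\<Sum>x\<in>UNIV. mscale (A $ fst x $ snd x) (munit (fst x) (snd x))) $ i $ j = A $ i $ j" for i j
  proof -
    have "(\<Sum>x\<in>UNIV. mscale (A $ fst x $ snd x) (munit (fst x) (snd x))) $ i $ j
        = (\<Sum>x\<in>UNIV. if x = (i, j) then A $ i $ j else 0)"
      unfolding sum_component by (rule sum.cong) (auto simp: prod_eq_iff)
    then show ?thesis by simp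
  qed
  then show ?thesis
    by (simp add: vec_eq_iff case_prod_unfold)
qed

text \<open>Expand one argument after another in matrix units and keep a nonzero summand. The second
  conjunct records that the chosen units lie in the supports of the \<open>y k\<close>, so that
  grading conditions on \<open>y\<close> are inherited.\<close>

lemma mlin_nonzero_units:
  assumes f: "mlin m f" and "f y \<noteq> 0"
  shows "\<exists>I J. f (units I J) \<noteq> 0 \<and> (\<forall>k\<in>{1..m}. y k $ I k $ J k \<noteq> 0)"
proof -
  have "\<exists>I J. f (\<lambda>k. if k \<in> S then units I J k else y k) \<noteq> 0 \<and> (\<forall>k\<in>S. y k $ I k $ J k \<noteq> 0)"
    if "S \<subseteq> {1..m}" "finite S" for S
    using that(2,1)
  proof induction
    case empty
    then show ?case using assms by simp
  next
    case (insert k S)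
    then obtain I J where IJ: "f (\<lambda>k. if k \<in> S then units I J k else y k) \<noteq> 0"
      "\<forall>k\<in>S. y k $ I k $ J k \<noteq> 0"
      by auto
    let ?y = "\<lambda>k. if k \<in> S then units I J k else y k"
    have k: "k \<in> {1..m}" "k \<notin> S"
      using insert by auto
    have "?y = ?y(k := (\<Sum>x\<in>UNIV. mscale (y k $ fst x $ snd x) (munit (fst x) (snd x))))"
      using k munit_sum[of "y k"] by (auto simp: case_prod_unfold)
    moreover have "f (?y(k := (\<Sum>x\<in>UNIV. mscale (y k $ fst x $ snd x) (munit (fst x) (snd x)))))
        = (\<Sum>x\<in>UNIV. y k $ fst x $ snd x * f (?y(k := munit (fst x) (snd x))))"
      by (rule mlin_upd_sum[OF f k(1)]) simp
    ultimately have "f ?y = (\<Sum>x\<in>UNIV. y k $ fst x $ snd x * f (?y(k := munit (fst x) (snd x))))"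
      by simp
    then obtain x where "y k $ fst x $ snd x * f (?y(k := munit (fst x) (snd x))) \<noteq> 0"
      using IJ(1) by (metis (no_types, lifting) sum.neutral)
    moreover have "?y(k := munit (fst x) (snd x))
        = (\<lambda>i. if i \<in> insert k S then units (I(k := fst x)) (J(k := snd x)) i else y i)"
      using k by (auto simp: units_def)
    ultimately show ?case
      using IJ(2) k by (intro exI[of _ "I(k := fst x)"] exI[of _ "J(k := snd x)"]) auto
  qed
  from this[of "{1..m}"] obtain I J where
    *: "f (\<lambda>k. if k \<in> {1..m} then units I J k else y k) \<noteq> 0" "\<forall>k\<in>{1..m}. y k $ I k $ J k \<noteq> 0"
    by auto
  moreover have "f (\<lambda>k. if k \<in> {1..m} then units I J k else y k) = f (units I J)"
    by (rule mlin_cong[OF f]) simp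
  ultimately show ?thesis by metis
qed

section \<open>Equivariant multilinear maps\<close>

text \<open>Over commutative rings rather than fields, so that powers of
  \<open>generic_matrix\<close>, whose entries are polynomials, are covered as well.\<close>

primrec mpow :: "'k::comm_ring_1^'n^'n \<Rightarrow> nat \<Rightarrow> 'k^'n^'n" where
  "mpow A 0 = mat 1"
| "mpow A (Suc j) = A ** mpow A j"

lemma mpow_diagonal:
  fixes A :: "'k::comm_ring_1^'n::finite^'n"
  assumes "\<And>i j. i \<noteq> j \<Longrightarrow> A $ i $ j = 0"
  shows "mpow A e $ i $ j = (if i = j then (A $ i $ i) ^ e else 0)"
proof (induction e arbitrary: i j)
  case (Suc e)
  have "mpow A (Suc e) $ i $ j = (\<Sum>l\<in>UNIV. if l = i then A $ i $ i * mpow A e $ i $ j else 0)"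
    unfolding mpow.simps matrix_matrix_mult_def vec_lambda_beta
    by (rule sum.cong) (use assms in auto)
  then show ?case
    by (simp add: Suc)
qed (simp add: mat_def)

lemma mpow_conj:
  assumes "g' ** g = mat 1" "g ** g' = mat 1"
  shows "mpow (g ** A ** g') e = g ** mpow A e ** g'"
proof (induction e)
  case (Suc e)
  have "mpow (g ** A ** g') (Suc e) = g ** A ** (g' ** g) ** mpow A e ** g'"
    by (simp add: Suc matrix_mul_assoc)
  then show ?case
    by (simp add: assms matrix_mul_assoc)
qed (simp add: assms)

text \<open>If the exponents differed, every nonzero scalar would be a root of unity of one fixed
  order, and there are only finitely many of those.\<close>

lemma power_exponent_eq:
  assumes inf: "infinite (UNIV :: 'k::field set)" and eq: "\<And>z :: 'k. z \<noteq> 0 \<Longrightarrow> z ^ p = z ^ q"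
  shows "p = q"
proof -
  have False if "a < b" "\<And>z :: 'k. z \<noteq> 0 \<Longrightarrow> z ^ a = z ^ b" for a b
  proof -
    have "z ^ (b - a) = 1" if "z \<noteq> 0" for z :: 'k
      using \<open>\<And>z :: 'k. z \<noteq> 0 \<Longrightarrow> z ^ a = z ^ b\<close>[OF that] \<open>a < b\<close> that
      by (simp add: power_diff)
    then have "UNIV \<subseteq> insert 0 {z :: 'k. z ^ (b - a) = 1}"
      by auto
    moreover have "finite {z :: 'k. z ^ (b - a) = 1}"
      using \<open>a < b\<close> by (intro finite_roots_of_unity) simp
    ultimately show False
      using inf by (meson finite_insert finite_subset)
  qed
  from this[of p q] this[of q p] eq show ?thesis
    by (metis linorder_neqE_nat)
qed

lemma sum_delta_mult_left:
  fixes f x :: "'n::finite \<Rightarrow> 'k::comm_ring_1"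
  shows "(\<Sum>l\<in>UNIV. (if l = i then x l else 0) * f l) = x i * f i"
  by (subst sum.mono_neutral_right[of _ "{i}"]) auto

lemma sum_delta_mult_right:
  fixes f x :: "'n::finite \<Rightarrow> 'k::comm_ring_1"
  shows "(\<Sum>l\<in>UNIV. f l * (if l = i then x l else 0)) = f i * x i"
  by (subst sum.mono_neutral_right[of _ "{i}"]) auto

section \<open>Conjugation by diagonal and permutation matrices\<close>

definition diag :: "('n \<Rightarrow> 'k::field) \<Rightarrow> 'k^'n^'n" where
  "diag z = (\<chi> i j. if j = i then z j else 0)"

lemma diag_mult_nth: "(diag z ** A) $ i $ j = z i * A $ i $ j"
  by (simp add: diag_def matrix_matrix_mult_def sum_delta_mult_left)

lemma mult_diag_nth: "(A ** diag z) $ i $ j = A $ i $ j * z j"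
proof -
  have "(A ** diag z) $ i $ j = (\<Sum>l\<in>UNIV. A $ i $ l * (if l = j then z l else 0))"
    unfolding diag_def matrix_matrix_mult_def vec_lambda_beta by (rule sum.cong) auto
  then show ?thesis
    by (simp add: sum_delta_mult_right)
qed

definition perm_mat :: "('n \<Rightarrow> 'n) \<Rightarrow> 'k::field^'n^'n" where
  "perm_mat \<sigma> = (\<chi> i j. if i = \<sigma> j then 1 else 0)"

lemma perm_mat_conj_nth:
  fixes A :: "'k::field^'n::finite^'n"
  assumes "bij \<sigma>"
  shows "(perm_mat \<sigma> ** A ** Finite_Cartesian_Product.transpose (perm_mat \<sigma>)) $ \<sigma> i $ \<sigma> j = A $ i $ j"
proof -
  have 1: "(perm_mat \<sigma> ** B) $ \<sigma> i $ j = B $ i $ j" for B :: "'k^'n^'n" and j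
  proof -
    have "(perm_mat \<sigma> ** B) $ \<sigma> i $ j = (\<Sum>l\<in>UNIV. (if l = i then 1 else 0) * B $ l $ j)"
      unfolding perm_mat_def matrix_matrix_mult_def vec_lambda_beta
      by (rule sum.cong) (use bij_is_inj[OF assms] in \<open>auto dest: injD\<close>)
    then show ?thesis
      by (simp only: sum_delta_mult_left mult_1_left)
  qed
  have 2: "(B ** Finite_Cartesian_Product.transpose (perm_mat \<sigma>)) $ i $ \<sigma> j = B $ i $ j" for B :: "'k^'n^'n" and i
  proof -
    have "(B ** Finite_Cartesian_Product.transpose (perm_mat \<sigma>)) $ i $ \<sigma> j = (\<Sum>l\<in>UNIV. B $ i $ l * (if l = j then 1 else 0))"
      unfolding perm_mat_def Finite_Cartesian_Product.transpose_def matrix_matrix_mult_def vec_lambda_beta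
      by (rule sum.cong) (use bij_is_inj[OF assms] in \<open>auto dest: injD\<close>)
    then show ?thesis
      by (simp only: sum_delta_mult_right mult_1_right)
  qed
  show ?thesis
    by (simp only: 1 2)
qed

lemma perm_mat_conj_munit:
  assumes "bij \<sigma>"
  shows "perm_mat \<sigma> ** munit i j ** Finite_Cartesian_Product.transpose (perm_mat \<sigma>) = munit (\<sigma> i) (\<sigma> j)"
    (is "?l = ?r")
proof -
  have "?l $ a $ b = ?r $ a $ b" for a b
  proof -
    obtain a' b' where "a = \<sigma> a'" "b = \<sigma> b'"
      using bij_is_surj[OF assms] by (metis surjD)
    then show ?thesis
      using bij_is_inj[OF assms] by (simp add: perm_mat_conj_nth[OF assms] inj_eq)
  qed
  then show ?thesis
    by (simp add: vec_eq_iff)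
qed

lemma perm_mat_transpose:
  assumes "bij \<sigma>"
  shows "perm_mat \<sigma> ** Finite_Cartesian_Product.transpose (perm_mat \<sigma>) = mat 1"
    (is "?l = ?r")
proof -
  have "(perm_mat \<sigma> ** ?r ** Finite_Cartesian_Product.transpose (perm_mat \<sigma>)) $ a $ b = ?r $ a $ b" for a b
  proof -
    obtain a' b' where "a = \<sigma> a'" "b = \<sigma> b'"
      using bij_is_surj[OF assms] by (metis surjD)
    then show ?thesis
      using bij_is_inj[OF assms] by (simp only: perm_mat_conj_nth[OF assms]) (simp add: mat_def inj_eq)
  qed
  then show ?thesis
    by (simp add: vec_eq_iff)
qed

text \<open>Makes any three distinct indices consecutive in some cyclic ordering.\<close>

lemma ex_numbering:
  fixes x c e :: "'n::finite"
  assumes "distinct [x, c, e]"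
  obtains h where "bij_betw h UNIV {..<CARD('n)}" "h x = 0" "h c = 1" "h e = 2"
proof -
  let ?B = "UNIV - {x, c, e}"
  have card: "CARD('n) = card ?B + 3"
    using assms card_Diff_subset[of "{x, c, e}" UNIV] card_mono[of UNIV "{x, c, e}"] by simp
  obtain f where f: "bij_betw f ?B {..<card ?B}"
    using ex_bij_betw_finite_nat[of ?B] by (auto simp: atLeast0LessThan)
  define h where "h v = (if v = x then 0 else if v = c then 1 else if v = e then 2 else f v + 3)" for v
  have "bij_betw (\<lambda>v. f v + 3) ?B ((\<lambda>i. i + 3) ` {..<card ?B})"
    using bij_betw_trans[OF f inj_on_imp_bij_betw[of "\<lambda>i. i + 3"]] by (simp add: o_def inj_on_def)
  then have 1: "bij_betw h ?B ((\<lambda>i. i + 3) ` {..<card ?B})"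
    by (rule bij_betw_cong[THEN iffD1, rotated]) (auto simp: h_def)
  have 2: "bij_betw h {x, c, e} {0, 1, 2}"
    using assms by (auto simp: bij_betw_def h_def)
  have "bij_betw h (?B \<union> {x, c, e}) ((\<lambda>i. i + 3) ` {..<card ?B} \<union> {0, 1, 2})"
    by (rule bij_betw_combine[OF 1 2]) auto
  moreover have "(\<lambda>i. i + 3) ` {..<card ?B} \<union> {0, 1, 2} = {..<CARD('n)}"
  proof (rule equalityI; rule subsetI)
    fix i
    assume i: "i \<in> {..<CARD('n)}"
    show "i \<in> (\<lambda>i. i + 3) ` {..<card ?B} \<union> {0, 1, 2}"
    proof (cases "i < 3")
      case False
      then have "i = (i - 3) + 3" "i - 3 < card ?B"
        using i card by auto
      then show ?thesis by blast
    qed auto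
  qed (use card in auto)
  moreover have "?B \<union> {x, c, e} = UNIV"
    by auto
  ultimately have "bij_betw h UNIV {..<CARD('n)}"
    by simp
  moreover have "h x = 0" "h c = 1" "h e = 2"
    using assms by (auto simp: h_def)
  ultimately show ?thesis
    using that by blast
qed

lemma ex_cyclic_shift:
  fixes h :: "'n::finite \<Rightarrow> nat"
  assumes "bij_betw h UNIV {..<CARD('n)}"
  obtains \<sigma> where "bij \<sigma>" "\<And>v. h (\<sigma> v) = Suc (h v) mod CARD('n)"
proof -
  define \<sigma> where "\<sigma> v = inv_into UNIV h (Suc (h v) mod CARD('n))" for v
  have \<sigma>: "h (\<sigma> v) = Suc (h v) mod CARD('n)" for v
    using assms unfolding \<sigma>_def by (intro f_inv_into_f) (auto simp: bij_betw_def)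
  have lt: "h v < CARD('n)" for v
    using assms by (auto simp: bij_betw_def)
  have "inj \<sigma>"
  proof (rule injI)
    fix v w
    assume "\<sigma> v = \<sigma> w"
    then have "Suc (h v) mod CARD('n) = Suc (h w) mod CARD('n)"
      by (metis \<sigma>)
    then have "h v = h w"
      using lt[of v] lt[of w] by (auto simp: mod_Suc split: if_splits)
    then show "v = w"
      using assms by (auto simp: bij_betw_def dest: injD)
  qed
  then show ?thesis
    using that[of \<sigma>] \<sigma> by (simp add: bij_def finite_UNIV_inj_surj)
qed

text \<open>Written out by entries, so that a condition imposed on all values of an equivariant map
  turns into linear relations between the entries of one value.\<close>

lemma transvection:
  fixes A :: "'k::field^'n::finite^'n"
  assumes "a \<noteq> b"
  shows "(mat 1 + munit a b) ** (mat 1 - munit a b) = (mat 1 :: 'k^'n^'n)"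
    and "((mat 1 + munit a b) ** A ** (mat 1 - munit a b)) $ i $ j =
      A $ i $ j + (if i = a then A $ b $ j else 0)
      - (if j = b then A $ i $ a + (if i = a then A $ b $ a else 0) else (0 :: 'k))"
proof -
  have l: "((mat 1 + munit a b) ** A) $ i $ j = A $ i $ j + (if i = a then A $ b $ j else 0)"
    for A :: "'k^'n^'n" and i j
  proof -
    have "(munit a b ** A) $ i $ j = (if i = a then A $ b $ j else 0)"
      using sum_delta_mult_left[of b "\<lambda>_. 1 :: 'k" "\<lambda>l. A $ l $ j"]
      by (simp add: matrix_matrix_mult_def)
    moreover have "(mat 1 + munit a b) ** A = mat 1 ** A + munit a b ** A"
      by (simp add: matrix_matrix_mult_def distrib_right sum.distrib vec_eq_iff)
    ultimately show ?thesis
      by simp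
  qed
  have r: "(A ** (mat 1 - munit a b)) $ i $ j = A $ i $ j - (if j = b then A $ i $ a else 0)"
    for A :: "'k^'n^'n" and i j
  proof -
    have "(A ** munit a b) $ i $ j = (if j = b then A $ i $ a else 0)"
      using sum_delta_mult_right[of "\<lambda>l. A $ i $ l" a "\<lambda>_. 1 :: 'k"]
      by (simp add: matrix_matrix_mult_def)
    then show ?thesis
      by (simp add: matrix_matrix_mult_def right_diff_distrib sum_subtractf sum_delta_mult_right mat_def)
  qed
  show "(mat 1 + munit a b) ** (mat 1 - munit a b) = (mat 1 :: 'k^'n^'n)"
    using assms by (auto simp: vec_eq_iff r) (auto simp: mat_def)
  show "((mat 1 + munit a b) ** A ** (mat 1 - munit a b)) $ i $ j =
      A $ i $ j + (if i = a then A $ b $ j else 0)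
      - (if j = b then A $ i $ a + (if i = a then A $ b $ a else 0) else 0)"
    by (simp add: r l)
qed

text \<open>The properties of the evaluation map from which everything follows. For square matrices
  \<open>g ** g' = mat 1\<close> already makes \<open>g'\<close> the two-sided inverse.\<close>

locale equivariant =
  fixes P :: "(nat \<Rightarrow> 'k::field^'n::finite^'n) \<Rightarrow> 'k^'n^'n" and m :: nat
  assumes mlin: "mlin m (\<lambda>y. P y $ a $ b)"
    and conj: "g ** g' = mat 1 \<Longrightarrow> P (\<lambda>k. g ** y k ** g') = g ** P y ** g'"
    and inf: "infinite (UNIV :: 'k set)"
begin

text \<open>Conjugate by the diagonal matrix with entries \<open>z ^ h i\<close>: the unit at
  \<open>k\<close> is multiplied by \<open>z ^ (h (I k) - h (J k))\<close>, the entry at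
  \<open>(a, b)\<close> by \<open>z ^ (h a - h b)\<close>. Exponents are compared over all nonzero
  \<open>z\<close>, with sums on both sides to avoid subtraction of natural numbers.\<close>

lemma units_weight:
  fixes h :: "'n \<Rightarrow> nat"
  assumes "P (units I J) $ a $ b \<noteq> 0"
  shows "h a + (\<Sum>k\<in>{1..m}. h (J k)) = h b + (\<Sum>k\<in>{1..m}. h (I k))"
proof -
  have "z ^ (h a + (\<Sum>k\<in>{1..m}. h (J k))) = z ^ (h b + (\<Sum>k\<in>{1..m}. h (I k)))" if z: "z \<noteq> 0" for z :: 'k
  proof -
    let ?g = "diag (\<lambda>i. z ^ h i) :: 'k^'n^'n" and ?g' = "diag (\<lambda>i. inverse (z ^ h i)) :: 'k^'n^'n"
    let ?c = "\<lambda>k. z ^ h (I k) * inverse (z ^ h (J k))"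
    have "?g ** ?g' = mat 1"
      using z by (auto simp: vec_eq_iff mult_diag_nth) (auto simp: diag_def mat_def)
    then have "P (\<lambda>k. ?g ** units I J k ** ?g') = ?g ** P (units I J) ** ?g'"
      by (rule conj)
    moreover have "?g ** units I J k ** ?g' = mscale (?c k) (units I J k)" for k
      by (simp add: vec_eq_iff mult_diag_nth diag_mult_nth units_def)
    ultimately have "P (\<lambda>k. mscale (?c k) (units I J k)) $ a $ b
        = z ^ h a * P (units I J) $ a $ b * inverse (z ^ h b)"
      by (simp add: mult_diag_nth diag_mult_nth)
    moreover have "P (\<lambda>k. mscale (?c k) (units I J k)) $ a $ b
        = (\<Prod>k\<in>{1..m}. ?c k) * P (units I J) $ a $ b"
      by (rule mlin_scale[OF mlin])
    ultimately have *: "(\<Prod>k\<in>{1..m}. ?c k) = z ^ h a * inverse (z ^ h b)"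
      using assms by (simp only: mult.assoc mult.commute[of "P (units I J) $ a $ b"] mult_cancel_right
          flip: mult.assoc) simp
    have "(\<Prod>k\<in>{1..m}. ?c k)
        = z ^ (\<Sum>k\<in>{1..m}. h (I k)) * inverse (z ^ (\<Sum>k\<in>{1..m}. h (J k)))"
      unfolding power_sum prod.distrib prod_inversef[symmetric] by (simp add: o_def)
    then show ?thesis
      using z unfolding * by (simp add: power_add field_simps)
  qed
  then show ?thesis
    by (rule power_exponent_eq[OF inf])
qed

lemma units_perm:
  assumes "bij \<sigma>"
  shows "P (units (\<sigma> \<circ> I) (\<sigma> \<circ> J)) $ \<sigma> a $ \<sigma> b = P (units I J) $ a $ b"
proof -
  have "(units (\<sigma> \<circ> I) (\<sigma> \<circ> J) :: nat \<Rightarrow> 'k^'n^'n) = (\<lambda>k. perm_mat \<sigma> ** units I J k ** Finite_Cartesian_Product.transpose (perm_mat \<sigma>))"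
    by (simp add: units_def perm_mat_conj_munit[OF assms])
  then show ?thesis
    by (simp only: conj[OF perm_mat_transpose[OF assms]] perm_mat_conj_nth[OF assms])
qed

text \<open>Conjugation by \<open>mat 1 + munit a b\<close> turns the entry at \<open>(a, b)\<close>
  of a diagonal value into the difference of its entries at \<open>b\<close> and \<open>a\<close>,
  which must vanish.\<close>

lemma scalar_if_offdiag_0:
  assumes "\<And>y a b. a \<noteq> b \<Longrightarrow> P y $ a $ b = 0"
  shows "\<exists>c. P y = mat c"
proof -
  have "P y $ a $ a = P y $ b $ b" if "a \<noteq> b" for a b
  proof -
    have "P (\<lambda>k. (mat 1 + munit a b) ** y k ** (mat 1 - munit a b)) $ a $ b = 0"
      using assms that by blast
    then show ?thesis
      using that assms[of a b] assms[of b a]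
      by (simp add: conj[OF transvection(1)[OF that]] transvection(2)[OF that])
  qed
  then have "P y = mat (P y $ i $ i)" for i
    using assms by (simp add: vec_eq_iff mat_def) metis
  then show ?thesis by blast
qed

text \<open>Conjugation by \<open>mat 1 + munit b a\<close> adds the entry at \<open>(a, b)\<close>
  to the diagonal entry at \<open>b\<close> and leaves the one at a third index \<open>c\<close>
  alone.\<close>

lemma scalar_if_diag_constant:
  assumes n: "CARD('n) \<ge> 3" and const: "\<And>y a b. P y $ a $ a = P y $ b $ b"
  shows "\<exists>c. P y = mat c"
proof (rule scalar_if_offdiag_0)
  fix y and a b :: 'n
  assume ab: "a \<noteq> b"
  have "card {a, b} < CARD('n)"
    using n ab by simp
  then obtain c where c: "c \<notin> {a, b}"
    by (metis UNIV_eq_I less_irrefl)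
  have "P (\<lambda>k. (mat 1 + munit b a) ** y k ** (mat 1 - munit b a)) $ b $ b
      = P (\<lambda>k. (mat 1 + munit b a) ** y k ** (mat 1 - munit b a)) $ c $ c"
    by (rule const)
  then show "P y $ a $ b = 0"
    using ab c const[of y b c]
    by (simp add: conj[OF transvection(1)[OF ab[symmetric]]] transvection(2)[OF ab[symmetric]])
qed

text \<open>The matrices that are homogeneous of the degree of \<open>e\<^sub>I\<^sub>J\<close> for the grading of the
  matrix algebra by the residues of \<open>h j - h i\<close>.\<close>

definition graded :: "('n \<Rightarrow> nat) \<Rightarrow> (nat \<Rightarrow> 'n) \<Rightarrow> (nat \<Rightarrow> 'n) \<Rightarrow> (nat \<Rightarrow> 'k^'n^'n) set" where
  "graded h I J = {y. \<forall>k i j. y k $ i $ j \<noteq> 0 \<longrightarrow>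
    int CARD('n) dvd (int (h j) - int (h i)) - (int (h (J k)) - int (h (I k)))}"

lemma graded_line_closed: "line_closed (graded h I J)"
  unfolding line_closed_def graded_def line_def by (auto; metis mult_zero_right add_0_left diff_self)

lemma units_in_graded: "units I J \<in> graded h I J"
  by (simp add: graded_def units_def)

text \<open>The shift raises both indices of each unit by 1 modulo \<open>CARD('n)\<close>, so the
  difference is unchanged.\<close>

lemma units_perm_in_graded:
  assumes \<sigma>: "\<And>v. h (\<sigma> v) = Suc (h v) mod CARD('n)" and "units I J \<in> graded h I' J'"
  shows "units (\<sigma> \<circ> I) (\<sigma> \<circ> J) \<in> graded h I' J'"
proof -
  have d: "int CARD('n) dvd int (h (\<sigma> v)) - (int (h v) + 1)" for v
  proof -
    have "int (h (\<sigma> v)) = (int (h v) + 1) mod int CARD('n)"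
      by (simp add: \<sigma> zmod_int add.commute)
    then show ?thesis
      by (metis mod_eq_dvd_iff mod_mod_trivial)
  qed
  have "int CARD('n) dvd (int (h (\<sigma> (J k))) - int (h (\<sigma> (I k)))) - (int (h (J' k)) - int (h (I' k)))" for k
  proof -
    have "int CARD('n) dvd (int (h (J k)) - int (h (I k))) - (int (h (J' k)) - int (h (I' k)))"
      using assms(2) by (simp add: graded_def units_def)
    from dvd_add[OF dvd_diff[OF d[of "J k"] d[of "I k"]] this] show ?thesis
      by (simp add: algebra_simps)
  qed
  then show ?thesis
    by (auto simp: graded_def units_def split: if_splits)
qed

text \<open>Some assignment of units from the supports of \<open>y\<close> has a nonzero value at
  \<open>(i, j)\<close>. Its degrees agree with those of \<open>units I J\<close>, and
  \<open>units_weight\<close> turns the sum of the degrees into the degree of the entry.\<close>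

lemma graded_value:
  assumes y: "y \<in> graded h I J" and "P (units I J) $ a $ b \<noteq> 0" "P y $ i $ j \<noteq> 0"
  shows "int CARD('n) dvd (int (h j) - int (h i)) - (int (h b) - int (h a))"
proof -
  obtain I' J' where *: "P (units I' J') $ i $ j \<noteq> 0" "\<forall>k\<in>{1..m}. y k $ I' k $ J' k \<noteq> 0"
    using mlin_nonzero_units[OF mlin assms(3)] by blast
  have "int CARD('n) dvd (\<Sum>k\<in>{1..m}. (int (h (J' k)) - int (h (I' k))) - (int (h (J k)) - int (h (I k))))"
    using y *(2) by (intro dvd_sum) (auto simp: graded_def)
  also have "\<dots> = (int (\<Sum>k\<in>{1..m}. h (J' k)) - int (\<Sum>k\<in>{1..m}. h (I' k)))
      - (int (\<Sum>k\<in>{1..m}. h (J k)) - int (\<Sum>k\<in>{1..m}. h (I k)))"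
    by (simp add: sum_subtractf)
  also have "\<dots> = (int (h j) - int (h i)) - (int (h b) - int (h a))"
    using units_weight[OF *(1), of h] units_weight[OF assms(2), of h] by linarith
  finally show ?thesis .
qed

lemma graded_residues_eq:
  assumes "bij_betw h (UNIV :: 'n set) {..<CARD('n)}" "int CARD('n) dvd int (h j) - int (h i)"
  shows "i = j"
proof -
  have "h i < CARD('n)" "h j < CARD('n)"
    using assms(1) by (auto simp: bij_betw_def)
  then have "\<bar>int (h j) - int (h i)\<bar> < int CARD('n)"
    by linarith
  then have "int (h j) - int (h i) = 0"
    using dvd_imp_le_int[OF _ assms(2)] by linarith
  then show ?thesis
    using assms(1) by (auto simp: bij_betw_def dest: injD)
qed

text \<open>On the space of assignments of a given degree, the diagonal entries of \<open>P\<close> have constant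
  ratios.  Shifting the indices cyclically preserves this space, so the diagonal entries form a
  geometric progression in every cyclic ordering of the indices.\<close>

lemma diag_progression:
  assumes "\<nu> \<ge> 1" and pow: "\<And>y. \<exists>c. mpow (P y) \<nu> = mat c"
    and D: "P (units I J) $ a $ a \<noteq> 0" and dist: "distinct [x, c, e]"
  shows "P (units I J) $ c $ c * P (units I J) $ c $ c = P (units I J) $ x $ x * P (units I J) $ e $ e"
    and "P (units I J) $ c $ c \<noteq> 0"
proof -
  obtain h where h: "bij_betw h (UNIV :: 'n set) {..<CARD('n)}" and hx: "h x = 0" "h c = 1" "h e = 2"
    using ex_numbering[OF dist] by blast
  obtain \<sigma> where \<sigma>: "bij \<sigma>" "\<And>v. h (\<sigma> v) = Suc (h v) mod CARD('n)"
    using ex_cyclic_shift[OF h] by blast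
  have "card {x, c, e} \<le> CARD('n)"
    by (rule card_mono) auto
  then have n: "CARD('n) \<ge> 3"
    using dist by simp
  have inj: "inj h"
    using h by (simp add: bij_betw_def)
  have \<sigma>x: "\<sigma> x = c" and \<sigma>c: "\<sigma> c = e"
    by (rule injD[OF inj]; use \<sigma>(2)[of x] \<sigma>(2)[of c] hx n in simp)+
  \<comment> \<open>By \<open>D\<close> the values on this graded piece have degree 0, and since
    \<open>h\<close> is a numbering, degree 0 means diagonal.\<close>
  have diag: "P y $ i $ j = 0" if "y \<in> graded h I J" "i \<noteq> j" for y i j
    using graded_value[OF that(1) D] graded_residues_eq[OF h, of j i] that(2) by auto
  have eq: "(P y $ i $ i) ^ \<nu> = (P y $ j $ j) ^ \<nu>" if "y \<in> graded h I J" for y i j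
  proof -
    obtain c where c: "mpow (P y) \<nu> = mat c"
      using pow by blast
    have "mpow (P y) \<nu> $ i $ i = (P y $ i $ i) ^ \<nu>" for i
      by (subst mpow_diagonal) (use diag[OF that] in auto)
    from this[of i] this[of j] show ?thesis
      by (simp add: c mat_def)
  qed
  have nz: "P (units I J) $ i $ i \<noteq> 0" for i
  proof
    assume "P (units I J) $ i $ i = 0"
    then have "(P (units I J) $ a $ a) ^ \<nu> = 0"
      using eq[OF units_in_graded, of a i] \<open>\<nu> \<ge> 1\<close> by (simp add: power_0_left)
    then show False
      using D by simp
  qed
  have u: "units (\<sigma> \<circ> I) (\<sigma> \<circ> J) \<in> graded h I J"
    by (rule units_perm_in_graded[of h \<sigma> I J I J, OF \<sigma>(2) units_in_graded])
  \<comment> \<open>The entries at \<open>c\<close> and \<open>e\<close> keep their ratio under the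
    shift, and by \<open>units_perm\<close> the shifted entries there are the original ones at
    \<open>x\<close> and \<open>c\<close>.\<close>
  have "P (units (\<sigma> \<circ> I) (\<sigma> \<circ> J)) $ \<sigma> x $ \<sigma> x * P (units I J) $ \<sigma> c $ \<sigma> c
      = P (units (\<sigma> \<circ> I) (\<sigma> \<circ> J)) $ \<sigma> c $ \<sigma> c * P (units I J) $ \<sigma> x $ \<sigma> x"
    by (rule line_poly_proportional[OF inf graded_line_closed mlin_line_poly[OF mlin]
          mlin_line_poly[OF mlin] \<open>\<nu> \<ge> 1\<close> _ units_in_graded nz u]) (rule eq)
  then show "P (units I J) $ c $ c * P (units I J) $ c $ c = P (units I J) $ x $ x * P (units I J) $ e $ e"
    unfolding units_perm[OF \<sigma>(1)] by (simp only: \<sigma>x \<sigma>c)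
  show "P (units I J) $ c $ c \<noteq> 0"
    by (rule nz)
qed

lemma power_scalar_imp_scalar:
  assumes n: "CARD('n) \<ge> 4" and \<nu>: "\<nu> \<ge> 1" and pow: "\<And>y. \<exists>c. mpow (P y) \<nu> = mat c"
  shows "\<exists>c. P y = mat c"
proof (rule scalar_if_diag_constant)
  show "P y $ a $ a = P y $ b $ b" for y a b
  proof (rule ccontr)
    assume ab: "P y $ a $ a \<noteq> P y $ b $ b"
    then have "a \<noteq> b"
      by blast
    have "mlin m (\<lambda>y. P y $ a $ a - P y $ b $ b)"
      by (intro mlin_diff mlin)
    then obtain I J where IJ: "P (units I J) $ a $ a - P (units I J) $ b $ b \<noteq> 0"
      using mlin_nonzero_units[of m "\<lambda>y. P y $ a $ a - P y $ b $ b" y] ab by auto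
    then obtain d where d: "P (units I J) $ d $ d \<noteq> 0"
      by (metis diff_self)
    have "card {a, b} < CARD('n)"
      using n \<open>a \<noteq> b\<close> by simp
    then obtain c where c: "c \<notin> {a, b}"
      by (metis UNIV_eq_I less_irrefl)
    have "card {a, b, c} < CARD('n)"
      using n by (simp add: card_insert_if)
    then obtain e where e: "e \<notin> {a, b, c}"
      by (metis UNIV_eq_I less_irrefl)
    \<comment> \<open>With \<open>D\<close> the diagonal of \<open>P (units I J)\<close>, the first
      two triples give \<open>D_c^2 = D_a D_e = D_b D_e\<close>, and the third gives
      \<open>D_e \<noteq> 0\<close>. Four distinct indices occur, whence
      \<open>CARD('n) \<ge> 4\<close>.\<close>
    have "distinct [a, c, e]" "distinct [b, c, e]" "distinct [a, e, b]"
      using \<open>a \<noteq> b\<close> c e by auto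
    then have "P (units I J) $ a $ a * P (units I J) $ e $ e = P (units I J) $ b $ b * P (units I J) $ e $ e"
      "P (units I J) $ e $ e \<noteq> 0"
      using diag_progression[OF \<nu> pow d] by metis+
    then show False
      using IJ by simp
  qed
qed (use n in simp)

end

section \<open>A cyclic value\<close>

text \<open>A weighted permutation matrix with all weights nonzero; it is applied to cyclic shifts
  \<open>\<sigma>\<close>.\<close>

definition cyclic :: "('n \<Rightarrow> 'n) \<Rightarrow> 'k::field^'n^'n \<Rightarrow> bool" where
  "cyclic \<sigma> C \<longleftrightarrow> (\<forall>i j. C $ i $ j \<noteq> 0 \<longleftrightarrow> j = \<sigma> i)"

lemma cyclic_mult_nth:
  fixes C :: "'k::field^'n::finite^'n"
  assumes "cyclic \<sigma> C"
  shows "(C ** A) $ i $ j = C $ i $ \<sigma> i * A $ \<sigma> i $ j"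
proof -
  have "(C ** A) $ i $ j = (\<Sum>l\<in>UNIV. (if l = \<sigma> i then C $ i $ l else 0) * A $ l $ j)"
    unfolding matrix_matrix_mult_def vec_lambda_beta
    by (rule sum.cong) (use assms in \<open>auto simp: cyclic_def\<close>)
  then show ?thesis
    by (simp only: sum_delta_mult_left)
qed

lemma cyclic_mpow:
  fixes C :: "'k::field^'n::finite^'n"
  assumes C: "cyclic \<sigma> C"
  shows "mpow C e $ i $ j \<noteq> 0 \<longleftrightarrow> j = (\<sigma> ^^ e) i"
proof (induction e arbitrary: i)
  case (Suc e)
  have "C $ i $ \<sigma> i \<noteq> 0"
    using C by (simp add: cyclic_def)
  then show ?case
    by (simp add: cyclic_mult_nth[OF C] Suc funpow_swap1)
qed (auto simp: mat_def)

lemma mpow_commute: "A ** mpow A e = mpow A e ** A"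
  by (induction e) (simp_all add: matrix_mul_assoc)

lemma funpow_shift:
  assumes "\<And>v. h (\<sigma> v) = Suc (h v) mod n" "\<And>v. h v < n"
  shows "h ((\<sigma> ^^ t) v) = (h v + t) mod n"
  by (induction t) (simp_all add: assms mod_Suc_eq)

text \<open>The power is diagonal because \<open>CARD('n)\<close> shifts are the identity. It
  commutes with \<open>C\<close>, so its diagonal is constant along \<open>\<sigma>\<close>, which
  reaches every index.\<close>

lemma cyclic_mpow_card:
  fixes C :: "'k::field^'n::finite^'n"
  assumes C: "cyclic \<sigma> C" and h: "bij_betw h UNIV {..<CARD('n)}"
    and \<sigma>: "\<And>v. h (\<sigma> v) = Suc (h v) mod CARD('n)"
  obtains c where "c \<noteq> 0" "mpow C CARD('n) = mat c"
proof -
  let ?D = "mpow C CARD('n)"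
  have inj: "inj h" and lt: "h v < CARD('n)" for v
    using h by (auto simp: bij_betw_def)
  have pow: "h ((\<sigma> ^^ t) v) = (h v + t) mod CARD('n)" for t v
    by (rule funpow_shift[of h \<sigma>, OF \<sigma> lt])
  have "(\<sigma> ^^ CARD('n)) v = v" for v
    by (rule injD[OF inj]) (simp add: pow lt)
  then have D: "?D $ i $ j \<noteq> 0 \<longleftrightarrow> j = i" for i j
    using cyclic_mpow[OF C] by simp
  have step: "?D $ \<sigma> i $ \<sigma> i = ?D $ i $ i" for i
  proof -
    have "(?D ** C) $ i $ \<sigma> i = (\<Sum>l\<in>UNIV. (if l = i then ?D $ i $ l else 0) * C $ l $ \<sigma> i)"
      unfolding matrix_matrix_mult_def vec_lambda_beta
      by (rule sum.cong) (use D in auto)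
    also have "\<dots> = ?D $ i $ i * C $ i $ \<sigma> i"
      by (simp only: sum_delta_mult_left)
    finally have "C $ i $ \<sigma> i * ?D $ \<sigma> i $ \<sigma> i = ?D $ i $ i * C $ i $ \<sigma> i"
      using cyclic_mult_nth[OF C, of ?D i "\<sigma> i"] by (simp only: mpow_commute)
    moreover have "C $ i $ \<sigma> i \<noteq> 0"
      using C by (simp add: cyclic_def)
    ultimately show ?thesis
      by simp
  qed
  obtain o' where o': "h o' = 0"
    using h by (metis UNIV_I bij_betw_def imageE lessThan_iff zero_less_card_finite)
  have "?D $ (\<sigma> ^^ t) o' $ (\<sigma> ^^ t) o' = ?D $ o' $ o'" for t
    by (induction t) (simp_all add: step)
  moreover have "(\<sigma> ^^ h v) o' = v" for v
    by (rule injD[OF inj]) (simp add: pow o' lt)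
  ultimately have "?D $ v $ v = ?D $ o' $ o'" for v
    by metis
  then have "?D $ i $ j = mat (?D $ o' $ o') $ i $ j" for i j
    using D[of i j] by (auto simp: mat_def)
  then have "?D = mat (?D $ o' $ o')"
    unfolding vec_eq_iff by blast
  moreover have "?D $ o' $ o' \<noteq> 0"
    using D by simp
  ultimately show ?thesis
    using that by blast
qed

context equivariant
begin

text \<open>Take a unit assignment with a nonzero off-diagonal entry and number the indices so that
  this entry has degree 1. All values on its graded piece are then supported on the positions
  \<open>(i, \<sigma> i)\<close>.\<close>

lemma ex_cyclic_value:
  assumes n: "CARD('n) \<ge> 3" and ns: "\<not> (\<exists>c. P y = mat c)"
  obtains h \<sigma> z where "bij_betw h (UNIV :: 'n set) {..<CARD('n)}"
    "\<And>v. h (\<sigma> v) = Suc (h v) mod CARD('n)" "cyclic \<sigma> (P z)"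
proof -
  obtain y a b where ab: "a \<noteq> b" "P y $ a $ b \<noteq> 0"
    using scalar_if_offdiag_0[of y] ns by metis
  obtain I J where IJ: "P (units I J) $ a $ b \<noteq> 0"
    using mlin_nonzero_units[OF mlin ab(2)] by blast
  have "card {a, b} < CARD('n)"
    using n ab(1) by simp
  then obtain e where "e \<notin> {a, b}"
    by (metis UNIV_eq_I less_irrefl)
  then have "distinct [a, b, e]"
    using ab(1) by auto
  then obtain h where h: "bij_betw h (UNIV :: 'n set) {..<CARD('n)}" and ha: "h a = 0" "h b = 1"
    using ex_numbering by blast
  obtain \<sigma> where \<sigma>: "bij \<sigma>" "\<And>v. h (\<sigma> v) = Suc (h v) mod CARD('n)"
    using ex_cyclic_shift[OF h] by blast
  have inj: "inj h" and lt: "h v < CARD('n)" for v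
    using h by (auto simp: bij_betw_def)
  have pow: "h ((\<sigma> ^^ t) v) = (h v + t) mod CARD('n)" for t v
    by (rule funpow_shift[of h \<sigma>, OF \<sigma>(2) lt])
  have b: "b = \<sigma> a"
    by (rule injD[OF inj]) (use \<sigma>(2)[of a] ha n in simp)
  have supp: "j = \<sigma> i" if "y \<in> graded h I J" "P y $ i $ j \<noteq> 0" for y i j
  proof -
    have "int (h (\<sigma> i)) = (int (h i) + 1) mod int CARD('n)"
      by (simp add: \<sigma> zmod_int add.commute)
    then have "int CARD('n) dvd int (h (\<sigma> i)) - (int (h i) + 1)"
      by (metis mod_eq_dvd_iff mod_mod_trivial)
    moreover have "int CARD('n) dvd (int (h j) - int (h i)) - (int (h b) - int (h a))"
      by (rule graded_value[OF that(1) IJ that(2)])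
    ultimately have "int CARD('n) dvd (int (h j) - int (h i)) - (int (h b) - int (h a))
        - (int (h (\<sigma> i)) - (int (h i) + 1))"
      by (metis dvd_diff)
    then have "int CARD('n) dvd int (h j) - int (h (\<sigma> i))"
      by (simp add: ha)
    then show ?thesis
      by (metis graded_residues_eq[OF h])
  qed
  \<comment> \<open>Repeated shifts carry the nonzero entry through all positions
    \<open>(i, \<sigma> i)\<close>; genericity then yields one \<open>z\<close> at which all of them
    are nonzero.\<close>
  have "units ((\<sigma> ^^ t) \<circ> I) ((\<sigma> ^^ t) \<circ> J) \<in> graded h I J \<and>
      P (units ((\<sigma> ^^ t) \<circ> I) ((\<sigma> ^^ t) \<circ> J)) $ (\<sigma> ^^ t) a $ (\<sigma> ^^ t) b \<noteq> 0" for t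
  proof (induction t)
    case 0
    then show ?case using IJ units_in_graded by simp
  next
    case (Suc t)
    then show ?case
      using units_perm_in_graded[of h \<sigma> "(\<sigma> ^^ t) \<circ> I" "(\<sigma> ^^ t) \<circ> J" I J, OF \<sigma>(2)]
        units_perm[OF \<sigma>(1), of "(\<sigma> ^^ t) \<circ> I" "(\<sigma> ^^ t) \<circ> J"]
      by (simp add: o_def)
  qed
  moreover have "(\<sigma> ^^ h i) a = i" for i
    by (rule injD[OF inj]) (simp add: pow ha lt)
  moreover have "(\<sigma> ^^ t) b = \<sigma> ((\<sigma> ^^ t) a)" for t
    by (simp add: b funpow_swap1)
  ultimately have "\<exists>y\<in>graded h I J. P y $ i $ \<sigma> i \<noteq> 0" for i
    by metis
  then have "\<exists>z\<in>graded h I J. \<forall>i\<in>UNIV. P z $ i $ \<sigma> i \<noteq> 0"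
    using units_in_graded mlin_line_poly[OF mlin]
    by (intro line_poly_common_nonzero_finite[OF inf graded_line_closed]) auto
  then obtain z where "z \<in> graded h I J" "\<And>i. P z $ i $ \<sigma> i \<noteq> 0"
    by blast
  then have "cyclic \<sigma> (P z)"
    using supp unfolding cyclic_def by metis
  then show ?thesis
    using that h \<sigma>(2) by blast
qed

end

section \<open>Evaluation of noncommutative polynomials\<close>

lemma poly_mapping_eq_sum_single:
  "f = (\<Sum>k\<in>Poly_Mapping.keys f. Poly_Mapping.single k (Poly_Mapping.lookup f k))"
proof (rule poly_mapping_eqI)
  fix k
  have "Poly_Mapping.lookup (\<Sum>k\<in>Poly_Mapping.keys f. Poly_Mapping.single k (Poly_Mapping.lookup f k)) k
      = (\<Sum>l\<in>Poly_Mapping.keys f. if l = k then Poly_Mapping.lookup f l else 0)"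
    unfolding lookup_sum by (rule sum.cong) (auto simp: lookup_single when_def)
  then show "Poly_Mapping.lookup f k = Poly_Mapping.lookup
      (\<Sum>k\<in>Poly_Mapping.keys f. Poly_Mapping.single k (Poly_Mapping.lookup f k)) k"
    by (simp add: in_keys_iff)
qed

lemma poly_mapping_mult_eq_sum:
  "f * g = (\<Sum>s\<in>Poly_Mapping.keys f. \<Sum>t\<in>Poly_Mapping.keys g.
    Poly_Mapping.single s (Poly_Mapping.lookup f s) * Poly_Mapping.single t (Poly_Mapping.lookup g t))"
  by (subst (1) poly_mapping_eq_sum_single[of f], subst (1) poly_mapping_eq_sum_single[of g])
    (simp add: sum_product)

lemma matrix_mult_sum:
  fixes F :: "'a \<Rightarrow> 'k::comm_ring_1^'n::finite^'n"
  shows "(\<Sum>s\<in>S. F s) ** (\<Sum>t\<in>T. G t) = (\<Sum>s\<in>S. \<Sum>t\<in>T. F s ** G t)"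
proof -
  have l: "(\<Sum>s\<in>S. F s) ** B = (\<Sum>s\<in>S. F s ** B)" for B
    by (simp add: vec_eq_iff matrix_matrix_mult_def sum_distrib_right sum.swap[of _ UNIV S])
  have r: "B ** (\<Sum>t\<in>T. G t) = (\<Sum>t\<in>T. B ** G t)" for B :: "'k^'n^'n"
    by (simp add: vec_eq_iff matrix_matrix_mult_def sum_distrib_left sum.swap[of _ UNIV T])
  show ?thesis
    by (simp only: l) (simp only: r)
qed

lemma mat_mult: "mat c ** A = mscale c (A :: 'k::field^'n::finite^'n)"
  by (simp add: vec_eq_iff matrix_matrix_mult_def mat_def if_distrib[of "\<lambda>x. x * _"] cong: if_cong)

lemma mscale_mult_left: "mscale c A ** B = mscale c (A ** B)"
  and mscale_mult_right: "A ** mscale c B = mscale c (A ** B)"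
  for A B :: "'k::field^'n::finite^'n"
  by (simp_all add: vec_eq_iff matrix_matrix_mult_def sum_distrib_left mult_ac)

lemma word_eval_plus:
  fixes a :: "'v \<Rightarrow> 'k::field^'n::finite^'n"
  shows "word_eval a (u + w) = word_eval a u ** word_eval a w"
proof -
  have "foldr (\<lambda>v M. a v ** M) us B = foldr (\<lambda>v M. a v ** M) us (mat 1) ** B" for us and B :: "'k^'n^'n"
    by (induction us) (simp_all add: matrix_mul_assoc)
  then show ?thesis
    unfolding word_eval_def plus_ncword_def ncword.sel foldr_append o_apply .
qed

lemma nc_eval_single: "nc_eval a (Poly_Mapping.single w c) = mscale c (word_eval a w)"
  by (simp add: nc_eval_def mat_mult)

lemma nc_eval_add: "nc_eval a (p + q) = nc_eval a p + nc_eval a q"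
  unfolding nc_eval_def
  by (rule setsum_keys_plus_distrib) (simp_all add: mat_mult vec_eq_iff algebra_simps)

lemma nc_eval_0 [simp]: "nc_eval a 0 = 0"
  by (simp add: nc_eval_def)

lemma nc_eval_sum: "nc_eval a (\<Sum>s\<in>S. F s) = (\<Sum>s\<in>S. nc_eval a (F s))"
  by (induction S rule: infinite_finite_induct) (simp_all add: nc_eval_add)

lemma nc_eval_eq_sum:
  "nc_eval a p = (\<Sum>s\<in>Poly_Mapping.keys p. nc_eval a (Poly_Mapping.single s (Poly_Mapping.lookup p s)))"
  unfolding nc_eval_sum[symmetric] poly_mapping_eq_sum_single[symmetric] ..

lemma nc_eval_mult: "nc_eval a (p * q) = nc_eval a p ** nc_eval a q"
proof -
  have "nc_eval a (Poly_Mapping.single s c * Poly_Mapping.single t d)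
      = nc_eval a (Poly_Mapping.single s c) ** nc_eval a (Poly_Mapping.single t d)" for s t c d
    by (simp add: mult_single nc_eval_single word_eval_plus mscale_mult_left mscale_mult_right)
      (simp add: vec_eq_iff)
  then show ?thesis
    unfolding poly_mapping_mult_eq_sum[of p q] nc_eval_sum
    by (simp add: nc_eval_eq_sum[of a p] nc_eval_eq_sum[of a q] matrix_mult_sum)
qed

lemma nc_eval_power: "nc_eval a (p ^ e) = mpow (nc_eval a p) e"
proof (induction e)
  case 0
  have "nc_eval a (Poly_Mapping.single 0 1) = mat 1"
    by (simp add: nc_eval_single word_eval_def zero_ncword_def)
  then show ?case by simp
qed (simp add: nc_eval_mult)

section \<open>Multilinearity and equivariance of the evaluation map\<close>

lemma mlin_sum:
  assumes "\<And>s. s \<in> S \<Longrightarrow> mlin m (f s)"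
  shows "mlin m (\<lambda>y. \<Sum>s\<in>S. c s * f s y)"
  unfolding mlin_def
proof (intro conjI allI ballI impI)
  fix y z :: "nat \<Rightarrow> 'b^'c^'c"
  assume "\<forall>k\<in>{1..m}. y k = z k"
  then show "(\<Sum>s\<in>S. c s * f s y) = (\<Sum>s\<in>S. c s * f s z)"
    by (intro sum.cong refl arg_cong[where f = "(*) _"] mlin_cong[OF assms]) auto
next
  fix k y A B d
  assume "k \<in> {1..m}"
  then have "(\<Sum>s\<in>S. c s * f s (y(k := A + mscale d B)))
      = (\<Sum>s\<in>S. c s * f s (y(k := A)) + d * (c s * f s (y(k := B))))"
    by (intro sum.cong refl) (simp only: mlin_upd[OF assms] distrib_left mult.left_commute)
  then show "(\<Sum>s\<in>S. c s * f s (y(k := A + mscale d B)))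
      = (\<Sum>s\<in>S. c s * f s (y(k := A))) + d * (\<Sum>s\<in>S. c s * f s (y(k := B)))"
    by (simp only: sum.distrib sum_distrib_left)
qed

lemma word_eval_upd_notin:
  "k \<notin> set ws \<Longrightarrow> word_eval (y(k := A)) (NCWord ws) = word_eval y (NCWord ws)"
  by (induction ws) (auto simp: word_eval_def)

lemma word_eval_Cons: "word_eval y (NCWord (v # ws)) = y v ** word_eval y (NCWord ws)"
  by (simp add: word_eval_def)

text \<open>The letter \<open>k\<close> occurs exactly once, so the update affects a single factor
  of the product.\<close>

lemma word_eval_upd:
  assumes "distinct ws" "k \<in> set ws"
  shows "word_eval (y(k := A + mscale c B)) (NCWord ws)
    = word_eval (y(k := A)) (NCWord ws) + mscale c (word_eval (y(k := B)) (NCWord ws))"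
  using assms
proof (induction ws)
  case (Cons v ws)
  show ?case
  proof (cases "v = k")
    case True
    have "(A + mscale c B) ** M = A ** M + mscale c (B ** M)" for M
      by (simp add: vec_eq_iff matrix_matrix_mult_def algebra_simps sum.distrib sum_distrib_left)
    moreover have "word_eval (y(v := A)) (NCWord ws) = word_eval y (NCWord ws)" for A
      using Cons.prems by (intro word_eval_upd_notin) simp
    ultimately show ?thesis
      unfolding True[symmetric] by (simp only: word_eval_Cons fun_upd_same)
  next
    case False
    with Cons have "word_eval (y(k := A + mscale c B)) (NCWord ws)
        = word_eval (y(k := A)) (NCWord ws) + mscale c (word_eval (y(k := B)) (NCWord ws))"
      by (metis distinct.simps(2) set_ConsD)
    then show ?thesis
      by (simp only: word_eval_Cons fun_upd_other[OF False] matrix_add_ldistrib mscale_mult_right)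
  qed
qed simp

lemma word_eval_conj:
  fixes g g' :: "'k::field^'n::finite^'n"
  assumes "g ** g' = mat 1"
  shows "word_eval (\<lambda>k. g ** y k ** g') (NCWord ws) = g ** word_eval y (NCWord ws) ** g'"
proof (induction ws)
  case (Cons v ws)
  have "g' ** g = mat 1"
    using assms by (rule matrix_left_right_inverse1)
  then have "g ** y v ** g' ** (g ** word_eval y (NCWord ws) ** g')
      = g ** y v ** word_eval y (NCWord ws) ** g'"
    by (metis matrix_mul_assoc matrix_mul_rid)
  then show ?case
    by (simp add: word_eval_Cons Cons matrix_mul_assoc)
qed (simp add: word_eval_def assms)

lemma multilinear_equivariant:
  fixes p :: "(nat, 'k::field) free_algebra"
  assumes "multilinear m p" and "infinite (UNIV :: 'k set)"
  shows "equivariant (\<lambda>y. nc_eval y p :: 'k^'n::finite^'n) m"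
proof
  let ?w = "\<lambda>\<pi>. NCWord (map \<pi> [1..<Suc m])"
  obtain c where p: "p = (\<Sum>\<pi> | \<pi> permutes {1..m}. Poly_Mapping.single (?w \<pi>) (c \<pi>))"
    using assms(1) unfolding multilinear_def by blast
  have eval: "nc_eval y p = (\<Sum>\<pi> | \<pi> permutes {1..m}. mscale (c \<pi>) (word_eval y (?w \<pi>)))"
    for y :: "nat \<Rightarrow> 'k^'n^'n"
    by (simp only: p nc_eval_sum nc_eval_single)
  show "mlin m (\<lambda>y. nc_eval y p $ a $ b)" for a b :: 'n
  proof -
    have "mlin m (\<lambda>y :: nat \<Rightarrow> 'k^'n^'n. word_eval y (?w \<pi>) $ a $ b)" if \<pi>: "\<pi> permutes {1..m}" for \<pi>
    proof -
      have set: "set (map \<pi> [1..<Suc m]) = {1..m}"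
        using permutes_image[OF \<pi>] by (simp add: atLeastLessThanSuc_atLeastAtMost del: upt_Suc)
      have dist: "distinct (map \<pi> [1..<Suc m])"
        using permutes_inj_on[OF \<pi>] by (simp add: distinct_map)
      show ?thesis
        unfolding mlin_def
      proof (intro conjI allI ballI impI)
        fix y z :: "nat \<Rightarrow> 'k^'n^'n"
        assume yz: "\<forall>k\<in>{1..m}. y k = z k"
        have "word_eval y (?w \<pi>) = word_eval z (?w \<pi>)"
          unfolding word_eval_def ncword.sel
          by (rule foldr_cong[OF refl refl]) (use yz in \<open>simp only: set\<close>)
        then show "word_eval y (?w \<pi>) $ a $ b = word_eval z (?w \<pi>) $ a $ b"
          by simp
      next
        fix k A B d and y :: "nat \<Rightarrow> 'k^'n^'n"
        assume "k \<in> {1..m}"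
        then have k: "k \<in> set (map \<pi> [1..<Suc m])"
          unfolding set .
        show "word_eval (y(k := A + mscale d B)) (?w \<pi>) $ a $ b
            = word_eval (y(k := A)) (?w \<pi>) $ a $ b + d * word_eval (y(k := B)) (?w \<pi>) $ a $ b"
          by (simp only: word_eval_upd[OF dist k] vector_add_component mscale_nth)
      qed
    qed
    then show ?thesis
      unfolding eval sum_component mscale_nth by (intro mlin_sum) simp
  qed
  show "nc_eval (\<lambda>k. g ** y k ** g') p = g ** nc_eval y p ** g'"
    if "g ** g' = mat 1" for g g' :: "'k^'n^'n" and y
  proof -
    have "g ** (\<Sum>s\<in>S. F s) ** g' = (\<Sum>s\<in>S. g ** F s ** g')" for S and F :: "(nat \<Rightarrow> nat) \<Rightarrow> 'k^'n^'n"
      using matrix_mult_sum[of "\<lambda>_. g" "{()}" F S] matrix_mult_sum[of "\<lambda>s. g ** F s" S "\<lambda>_. g'" "{()}"]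
      by simp
    then show ?thesis
      unfolding eval word_eval_conj[OF that]
      by (simp only: mscale_mult_left mscale_mult_right)
  qed
qed (fact assms(2))

section \<open>Polynomials in the matrix entries\<close>

lemma entry_eval_single:
  "entry_eval A (Poly_Mapping.single t c) = c * (\<Prod>(i, j)\<in>UNIV. (A $ i $ j) ^ Poly_Mapping.lookup t (i, j))"
  by (simp add: entry_eval_def)

lemma entry_eval_add: "entry_eval A (f + g) = entry_eval A f + entry_eval A g"
  unfolding entry_eval_def
  by (rule setsum_keys_plus_distrib) (simp_all add: distrib_right)

lemma entry_eval_0 [simp]: "entry_eval A 0 = 0"
  by (simp add: entry_eval_def)

lemma entry_eval_sum: "entry_eval A (\<Sum>s\<in>S. F s) = (\<Sum>s\<in>S. entry_eval A (F s))"
  by (induction S rule: infinite_finite_induct) (simp_all add: entry_eval_add)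

lemma entry_eval_eq_sum:
  "entry_eval A f = (\<Sum>s\<in>Poly_Mapping.keys f. entry_eval A (Poly_Mapping.single s (Poly_Mapping.lookup f s)))"
  unfolding entry_eval_sum[symmetric] poly_mapping_eq_sum_single[symmetric] ..

lemma entry_eval_mult: "entry_eval A (f * g) = entry_eval A f * entry_eval A g"
proof -
  have "entry_eval A (Poly_Mapping.single s c * Poly_Mapping.single t d)
      = entry_eval A (Poly_Mapping.single s c) * entry_eval A (Poly_Mapping.single t d)" for s t c d
    by (simp add: mult_single entry_eval_single lookup_add power_add prod.distrib case_prod_unfold mult_ac)
  then show ?thesis
    unfolding poly_mapping_mult_eq_sum[of f g] entry_eval_sum
    by (simp add: entry_eval_eq_sum[of A f] entry_eval_eq_sum[of A g] sum_product)
qed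

lemma entry_eval_1 [simp]: "entry_eval A 1 = 1"
  using entry_eval_single[of A 0 1] by simp

lemma entry_eval_uminus: "entry_eval A (- f) = - entry_eval A f"
  using entry_eval_add[of A f "- f"] by (simp add: eq_neg_iff_add_eq_0 add.commute)

lemma entry_eval_diff: "entry_eval A (f - g) = entry_eval A f - entry_eval A g"
  using entry_eval_add[of A f "- g"] by (simp add: entry_eval_uminus)

lemma entry_eval_const: "entry_eval A (Poly_Mapping.single 0 c) = c"
  by (simp add: entry_eval_single)

text \<open>The entries of its powers supply the polynomials that separate successive members of the
  chain of families.\<close>

definition generic_matrix :: "('n, 'k::field) entry_poly^'n^'n" where
  "generic_matrix = (\<chi> i j. Poly_Mapping.single (Poly_Mapping.single (i, j) 1) 1)"

lemma entry_eval_generic_matrix: "entry_eval A (generic_matrix $ i $ j) = A $ i $ j"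
proof -
  have "(\<Prod>(k, l)\<in>UNIV. (A $ k $ l) ^ Poly_Mapping.lookup (Poly_Mapping.single (i, j) 1) (k, l))
      = (\<Prod>x\<in>UNIV. if x = (i, j) then A $ i $ j else 1)"
    by (rule prod.cong) (auto simp: lookup_single when_def split: if_splits)
  then show ?thesis
    by (simp add: generic_matrix_def entry_eval_single)
qed

lemma entry_eval_mpow: "entry_eval A (mpow generic_matrix e $ i $ j) = mpow A e $ i $ j"
  by (induction e arbitrary: i)
    (simp_all add: mat_def matrix_matrix_mult_def entry_eval_sum entry_eval_mult entry_eval_generic_matrix)

section \<open>Prime ideals of rationally connected sets\<close>

text \<open>Rational functions with poles only at zeros of \<open>w\<close>; the values of
  \<open>h\<close> at those zeros are left free.\<close>

definition ratfn :: "('k::field \<Rightarrow> 'k) \<Rightarrow> ('k \<Rightarrow> 'k) \<Rightarrow> bool" where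
  "ratfn w h \<longleftrightarrow> (\<exists>N f. polyfn f \<and> (\<forall>r. w r \<noteq> 0 \<longrightarrow> h r * w r ^ N = f r))"

lemma ratfn_polyfn: "polyfn h \<Longrightarrow> ratfn w h"
  unfolding ratfn_def by (rule exI[of _ 0], rule exI[of _ h]) simp

lemma ratfn_add:
  assumes w: "polyfn w" and "ratfn w f" "ratfn w g"
  shows "ratfn w (\<lambda>r. f r + g r)"
proof -
  obtain M f' N g' where f: "polyfn f'" "\<And>r. w r \<noteq> 0 \<Longrightarrow> f r * w r ^ M = f' r"
    and g: "polyfn g'" "\<And>r. w r \<noteq> 0 \<Longrightarrow> g r * w r ^ N = g' r"
    using assms unfolding ratfn_def by blast
  have "(f r + g r) * w r ^ (M + N) = f' r * w r ^ N + g' r * w r ^ M" if "w r \<noteq> 0" for r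
    unfolding f(2)[OF that, symmetric] g(2)[OF that, symmetric] by (simp add: power_add algebra_simps)
  moreover have "polyfn (\<lambda>r. f' r * w r ^ N + g' r * w r ^ M)"
    by (intro polyfn_add polyfn_mult polyfn_power f g w)
  ultimately show ?thesis
    unfolding ratfn_def by blast
qed

lemma ratfn_mult:
  assumes "ratfn w f" "ratfn w g"
  shows "ratfn w (\<lambda>r. f r * g r)"
proof -
  obtain M f' N g' where f: "polyfn f'" "\<And>r. w r \<noteq> 0 \<Longrightarrow> f r * w r ^ M = f' r"
    and g: "polyfn g'" "\<And>r. w r \<noteq> 0 \<Longrightarrow> g r * w r ^ N = g' r"
    using assms unfolding ratfn_def by blast
  have "(f r * g r) * w r ^ (M + N) = f' r * g' r" if "w r \<noteq> 0" for r
    unfolding f(2)[OF that, symmetric] g(2)[OF that, symmetric] by (simp add: power_add algebra_simps)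
  moreover have "polyfn (\<lambda>r. f' r * g' r)"
    by (intro polyfn_mult f g)
  ultimately show ?thesis
    unfolding ratfn_def by blast
qed

lemma ratfn_sum:
  assumes "polyfn w" "\<And>s. s \<in> S \<Longrightarrow> ratfn w (f s)"
  shows "ratfn w (\<lambda>r. \<Sum>s\<in>S. f s r)"
  using assms(2)
  by (induction S rule: infinite_finite_induct) (simp_all add: ratfn_polyfn ratfn_add[OF assms(1)])

lemma ratfn_prod:
  assumes "\<And>s. s \<in> S \<Longrightarrow> ratfn w (f s)"
  shows "ratfn w (\<lambda>r. \<Prod>s\<in>S. f s r)"
  using assms
  by (induction S rule: infinite_finite_induct) (simp_all add: ratfn_polyfn ratfn_mult)

lemma ratfn_power: "ratfn w f \<Longrightarrow> ratfn w (\<lambda>r. f r ^ N)"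
  by (induction N) (simp_all add: ratfn_polyfn ratfn_mult)

lemma ratfn_entry_eval:
  fixes M :: "'k::field \<Rightarrow> 'k^'n::finite^'n"
  assumes "polyfn w" "\<And>i j. ratfn w (\<lambda>r. M r $ i $ j)"
  shows "ratfn w (\<lambda>r. entry_eval (M r) f)"
  unfolding entry_eval_def case_prod_unfold
  by (intro ratfn_sum ratfn_mult ratfn_prod ratfn_power assms ratfn_polyfn polyfn_const)

text \<open>The denominators of the connecting curve divide powers of \<open>w\<close>.\<close>

definition rat_connected :: "('k::field^'n::finite^'n) set \<Rightarrow> bool" where
  "rat_connected Z \<longleftrightarrow> (\<forall>A\<in>Z. \<forall>B\<in>Z. \<exists>w M. polyfn w \<and> w 0 \<noteq> 0 \<and> w 1 \<noteq> 0 \<and> M 0 = A \<and> M 1 = B \<and>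
    (\<forall>r. w r \<noteq> 0 \<longrightarrow> M r \<in> Z) \<and> (\<forall>i j. ratfn w (\<lambda>r. M r $ i $ j)))"

lemma ring_of_type_algebra_simps:
  "carrier ring_of_type_algebra = UNIV" "x \<otimes>\<^bsub>ring_of_type_algebra\<^esub> y = x * y"
  "x \<oplus>\<^bsub>ring_of_type_algebra\<^esub> y = x + y" "\<zero>\<^bsub>ring_of_type_algebra\<^esub> = 0" "\<one>\<^bsub>ring_of_type_algebra\<^esub> = 1"
  by (simp_all add: ring_of_type_algebra_def)

lemma ideal_vanishing_ideal:
  "ideal (vanishing_ideal Z) (ring_of_type_algebra :: ('n::finite, 'k::field) entry_poly ring)"
proof (rule idealI)
  let ?R = "ring_of_type_algebra :: ('n, 'k) entry_poly ring"
  show R: "ring ?R"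
    by (rule ring_from_type_algebra)
  show "subgroup (vanishing_ideal Z) (add_monoid ?R)"
  proof (rule group.subgroupI)
    show "Group.group (add_monoid ?R)"
      using abelian_group.a_group[OF ring.is_abelian_group[OF R]] .
    show "inv\<^bsub>add_monoid ?R\<^esub> f \<in> vanishing_ideal Z" if "f \<in> vanishing_ideal Z" for f
    proof -
      have "inv\<^bsub>add_monoid ?R\<^esub> f = - f"
        by (rule group.inv_equality[OF abelian_group.a_group[OF ring.is_abelian_group[OF R]]])
          (simp_all add: ring_of_type_algebra_simps)
      then show ?thesis
        using that by (simp add: vanishing_ideal_def entry_eval_uminus)
    qed
  qed (auto simp: vanishing_ideal_def ring_of_type_algebra_simps entry_eval_add intro!: exI[of _ 0])
qed (simp_all add: vanishing_ideal_def ring_of_type_algebra_simps entry_eval_mult)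

text \<open>Points where \<open>f\<close> and \<open>g\<close> do not vanish are joined by a curve
  inside \<open>Z\<close>. Pulled back and cleared of denominators, both become nonzero polynomials
  in one variable, so they are nonzero at a common point of the curve.\<close>

lemma primeideal_vanishing_ideal:
  assumes inf: "infinite (UNIV :: 'k::field set)" and "Z \<noteq> {}" and Z: "rat_connected Z"
  shows "primeideal (vanishing_ideal Z) (ring_of_type_algebra :: ('n::finite, 'k) entry_poly ring)"
proof (rule primeidealI)
  obtain A where A: "A \<in> Z"
    using assms by blast
  then have "1 \<notin> vanishing_ideal Z"
    by (auto simp: vanishing_ideal_def)
  then show "carrier ring_of_type_algebra \<noteq> vanishing_ideal Z"
    by (auto simp: ring_of_type_algebra_simps)
  show "f \<in> vanishing_ideal Z \<or> g \<in> vanishing_ideal Z"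
    if "f \<otimes>\<^bsub>ring_of_type_algebra\<^esub> g \<in> vanishing_ideal Z" for f g
  proof (rule ccontr)
    assume "\<not> ?thesis"
    then obtain A B where A: "A \<in> Z" "entry_eval A f \<noteq> 0" and B: "B \<in> Z" "entry_eval B g \<noteq> 0"
      by (auto simp: vanishing_ideal_def)
    obtain w and M :: "'k \<Rightarrow> 'k^'n^'n" where w: "polyfn w" "w 0 \<noteq> 0" "w 1 \<noteq> 0" and M: "M 0 = A" "M 1 = B"
      "\<And>r. w r \<noteq> 0 \<Longrightarrow> M r \<in> Z" "\<And>i j. ratfn w (\<lambda>r. M r $ i $ j)"
      using Z A B unfolding rat_connected_def by metis
    obtain N f' where f': "polyfn f'" "\<And>r. w r \<noteq> 0 \<Longrightarrow> entry_eval (M r) f * w r ^ N = f' r"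
      using ratfn_entry_eval[OF w(1) M(4), of f] unfolding ratfn_def by blast
    obtain N' g' where g': "polyfn g'" "\<And>r. w r \<noteq> 0 \<Longrightarrow> entry_eval (M r) g * w r ^ N' = g' r"
      using ratfn_entry_eval[OF w(1) M(4), of g] unfolding ratfn_def by blast
    \<comment> \<open>The factor \<open>w r\<close> keeps the common point away from the
      poles.\<close>
    have "\<exists>r. w r * f' r \<noteq> 0 \<and> g' r \<noteq> 0"
    proof (rule polyfn_common_nonzero[OF inf, where a = 0 and b = 1])
      show "polyfn (\<lambda>r. w r * f' r)"
        by (intro polyfn_mult w f')
      show "w 0 * f' 0 \<noteq> 0"
        using f'(2)[OF w(2)] w(2) A(2) M(1) by auto
      show "g' 1 \<noteq> 0"
        using g'(2)[OF w(3)] w(3) B(2) M(2) by auto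
    qed (rule g')
    then obtain r where r: "w r \<noteq> 0" "f' r \<noteq> 0" "g' r \<noteq> 0"
      by auto
    then have "entry_eval (M r) f \<noteq> 0" "entry_eval (M r) g \<noteq> 0"
      using f'(2)[OF r(1)] g'(2)[OF r(1)] by auto
    then have "entry_eval (M r) (f * g) \<noteq> 0"
      by (simp add: entry_eval_mult)
    then show False
      using that M(3)[OF r(1)] by (simp add: vanishing_ideal_def ring_of_type_algebra_simps)
  qed
qed (rule ideal_vanishing_ideal cring_from_type_algebra)+

lemma rat_connected_image:
  fixes P :: "(nat \<Rightarrow> 'k::field^'n::finite^'n) \<Rightarrow> 'k^'n^'n"
  assumes "\<And>i j. line_poly (\<lambda>y. P y $ i $ j)"
  shows "rat_connected (range P)"
  unfolding rat_connected_def
proof safe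
  fix y z
  show "\<exists>w M. polyfn w \<and> w 0 \<noteq> 0 \<and> w 1 \<noteq> 0 \<and> M 0 = P y \<and> M 1 = P z \<and>
    (\<forall>r. w r \<noteq> 0 \<longrightarrow> M r \<in> range P) \<and> (\<forall>i j. ratfn w (\<lambda>r. M r $ i $ j))"
    using assms
    by (intro exI[of _ "\<lambda>_. 1"] exI[of _ "\<lambda>r. P (line y z r)"])
      (auto simp: line_poly_def intro: ratfn_polyfn)
qed

text \<open>Conditions on scalar and conjugator are collected in \<open>H\<close>: shrinking
  \<open>H\<close> gives smaller families, and one lemma shows them rationally connected whenever
  \<open>H\<close> is closed under lines.\<close>

definition conj_family :: "'k::field^'n::finite^'n \<Rightarrow> ('k \<times> ('k^'n^'n)) set \<Rightarrow> ('k^'n^'n) set" where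
  "conj_family C H = {mscale s (g ** C ** g') | s g g'. (s, g) \<in> H \<and> g ** g' = mat 1}"

text \<open>The inverse by Cramer's rule, which exhibits its entries as polynomials in those of
  \<open>A\<close> divided by \<open>det A\<close>.\<close>

definition inverse_formula :: "'k::field^'n::finite^'n \<Rightarrow> 'k^'n^'n" where
  "inverse_formula A = (\<chi> k l. det (\<chi> i j. if j = k then axis l 1 $ i else A $ i $ j) / det A)"

lemma inverse_formula:
  fixes A :: "'k::field^'n::finite^'n"
  assumes "det A \<noteq> 0"
  shows "A ** inverse_formula A = mat 1"
proof -
  have "A *v column l (inverse_formula A) = axis l 1" for l
    by (subst cramer[OF assms]) (simp add: vec_eq_iff column_def inverse_formula_def)
  moreover have "(A ** B) $ i $ l = (A *v column l B) $ i" for B :: "'k^'n^'n" and i l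
    by (simp add: matrix_vector_mult_def matrix_matrix_mult_def column_def)
  ultimately show ?thesis
    by (simp add: vec_eq_iff mat_def axis_def)
qed

lemma polyfn_det:
  fixes G :: "'k::field \<Rightarrow> 'k^'n::finite^'n"
  assumes "\<And>i j. polyfn (\<lambda>r. G r $ i $ j)"
  shows "polyfn (\<lambda>r. det (G r))"
  unfolding det_def by (intro polyfn_sum polyfn_mult polyfn_const polyfn_prod assms)

lemma ratfn_inverse_formula:
  fixes G :: "'k::field \<Rightarrow> 'k^'n::finite^'n"
  assumes G: "\<And>i j. polyfn (\<lambda>r. G r $ i $ j)"
  shows "ratfn (\<lambda>r. det (G r)) (\<lambda>r. inverse_formula (G r) $ k $ l)"
proof -
  have "polyfn (\<lambda>r. (\<chi> i j. if j = k then axis l 1 $ i else G r $ i $ j) $ i $ j)" for i j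
    using G by (cases "j = k") auto
  from polyfn_det[OF this] show ?thesis
    unfolding ratfn_def inverse_formula_def by (intro exI[of _ 1] exI conjI) auto
qed

lemma inverse_unique:
  fixes A :: "'k::field^'n::finite^'n"
  assumes "A ** B = mat 1" "A ** B' = mat 1"
  shows "B = B'"
  using matrix_left_right_inverse1[OF assms(1)] assms(2)
  by (metis matrix_mul_assoc matrix_mul_lid matrix_mul_rid)

text \<open>Join the two pairs by a line in \<open>H\<close> and invert by Cramer's rule. The
  determinant along the line is the denominator and is nonzero at both ends.\<close>

lemma rat_connected_conj_family:
  fixes H :: "('k::field \<times> ('k^'n::finite^'n)) set"
  assumes H: "\<And>s g t h r. (s, g) \<in> H \<Longrightarrow> (t, h) \<in> H \<Longrightarrow>
    (s + r * (t - s), g + mscale r (h - g)) \<in> H"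
  shows "rat_connected (conj_family C H)"
  unfolding rat_connected_def
proof (intro ballI)
  fix A B
  assume "A \<in> conj_family C H" "B \<in> conj_family C H"
  then obtain s g g' t h h' where A: "A = mscale s (g ** C ** g')" "(s, g) \<in> H" "g ** g' = mat 1"
    and B: "B = mscale t (h ** C ** h')" "(t, h) \<in> H" "h ** h' = mat 1"
    unfolding conj_family_def by blast
  let ?s = "\<lambda>r. s + r * (t - s)" and ?g = "\<lambda>r. g + mscale r (h - g)"
  let ?M = "\<lambda>r. mscale (?s r) (?g r ** C ** inverse_formula (?g r))"
  have g01: "?g 0 = g" "?g 1 = h"
    by (auto simp: vec_eq_iff)
  have g: "polyfn (\<lambda>r. ?g r $ i $ j)" for i j
    by (simp only: vector_add_component mscale_nth)
      (intro polyfn_add polyfn_mult polyfn_const polyfn_ident)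
  have det: "det g \<noteq> 0" "det h \<noteq> 0"
    using A(3) B(3) matrix_left_right_inverse1 unfolding invertible_det_nz[symmetric] invertible_def by blast+
  have w: "polyfn (\<lambda>r. det (?g r))"
    by (rule polyfn_det[OF g])
  have s: "polyfn ?s"
    by (intro polyfn_add polyfn_mult polyfn_const polyfn_ident)
  have inv: "inverse_formula g = g'" "inverse_formula h = h'"
    using inverse_unique inverse_formula det A(3) B(3) by blast+
  have "ratfn (\<lambda>r. det (?g r)) (\<lambda>r. ?M r $ i $ j)" for i j
    unfolding mscale_nth matrix_matrix_mult_def vec_lambda_beta
    by (intro ratfn_mult ratfn_sum w ratfn_inverse_formula[OF g] ratfn_polyfn s g polyfn_const)
  moreover have "?M r \<in> conj_family C H" if "det (?g r) \<noteq> 0" for r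
    unfolding conj_family_def using inverse_formula[OF that] H[OF A(2) B(2)] by blast
  moreover have "?M 0 = A" "?M 1 = B"
    unfolding g01 inv A(1) B(1) by simp_all
  ultimately show "\<exists>w M. polyfn w \<and> w 0 \<noteq> 0 \<and> w 1 \<noteq> 0 \<and> M 0 = A \<and> M 1 = B \<and>
    (\<forall>r. w r \<noteq> 0 \<longrightarrow> M r \<in> conj_family C H) \<and> (\<forall>i j. ratfn w (\<lambda>r. M r $ i $ j))"
    using w det g01 by (intro exI[of _ "\<lambda>r. det (?g r)"] exI[of _ ?M]) simp
qed

section \<open>Chains of prime ideals\<close>

lemma krull_dim_quot_ge:
  fixes R (structure)
  assumes R: "cring R" and I: "ideal I R"
    and prime: "\<And>i. i \<le> k \<Longrightarrow> primeideal (Q i) R" and sub: "\<And>i. i \<le> k \<Longrightarrow> I \<subseteq> Q i"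
    and chain: "\<And>i. i < k \<Longrightarrow> Q i \<subset> Q (Suc i)"
  shows "krull_dim (R Quot I) \<ge> enat k"
proof -
  interpret R: cring R by (rule R)
  interpret I: ideal I R by (rule I)
  \<comment> \<open>As \<open>I \<subseteq> Q i\<close>, the ideal \<open>Q i\<close> is a union of
    cosets of \<open>I\<close>, so membership can be tested on any representative.\<close>
  have mem: "I +> a \<in> (+>) I ` Q i \<longleftrightarrow> a \<in> Q i" if i: "i \<le> k" and a: "a \<in> carrier R" for i a
  proof
    interpret Q: primeideal "Q i" R by (rule prime[OF i])
    assume "I +> a \<in> (+>) I ` Q i"
    then obtain q where q: "q \<in> Q i" "I +> a = I +> q"
      by blast
    have "\<zero> \<oplus> a \<in> I +> a"
      using I.zero_closed unfolding a_r_coset_def' by blast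
    then have "a \<in> I +> q"
      using q(2) a by simp
    then obtain x where "x \<in> I" "a = x \<oplus> q"
      unfolding a_r_coset_def' by blast
    then show "a \<in> Q i"
      using sub[OF i] q(1) Q.a_closed by blast
  qed blast
  have "primeideal ((+>) I ` Q i) (R Quot I)" if i: "i \<le> k" for i
  proof (rule primeidealI)
    interpret Q: primeideal "Q i" R by (rule prime[OF i])
    show "ideal ((+>) I ` Q i) (R Quot I)"
      by (rule R.ring_ideal_imp_quot_ideal[OF I Q.is_ideal])
    show "cring (R Quot I)"
      by (rule I.quotient_is_cring[OF R])
    have carr: "carrier (R Quot I) = (+>) I ` carrier R"
      by (auto simp: FactRing_def A_RCOSETS_def')
    obtain a where "a \<in> carrier R" "a \<notin> Q i"
      using Q.I_notcarr Q.a_subset by blast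
    then have "I +> a \<in> carrier (R Quot I)" "I +> a \<notin> (+>) I ` Q i"
      using mem[OF i] unfolding carr by simp_all
    then show "carrier (R Quot I) \<noteq> (+>) I ` Q i"
      by metis
    fix x y
    assume "x \<in> carrier (R Quot I)" "y \<in> carrier (R Quot I)" and xy: "x \<otimes>\<^bsub>R Quot I\<^esub> y \<in> (+>) I ` Q i"
    then obtain a b where ab: "a \<in> carrier R" "b \<in> carrier R" "x = I +> a" "y = I +> b"
      unfolding carr by blast
    have "I +> (a \<otimes> b) \<in> (+>) I ` Q i"
      using xy I.rcoset_mult_add[OF ab(1,2)] by (simp add: FactRing_def ab)
    then have "a \<otimes> b \<in> Q i"
      using mem[OF i] ab by simp
    then have "a \<in> Q i \<or> b \<in> Q i"
      by (rule Q.I_prime[OF ab(1,2)])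
    then show "x \<in> (+>) I ` Q i \<or> y \<in> (+>) I ` Q i"
      unfolding ab(3,4) by (metis imageI)
  qed
  moreover have "(+>) I ` Q i \<subset> (+>) I ` Q (Suc i)" if i: "i < k" for i
  proof -
    obtain a where a: "a \<in> Q (Suc i)" "a \<notin> Q i"
      using chain[OF i] by blast
    have "a \<in> carrier R"
      using a(1) prime[of "Suc i"] i by (meson Suc_leI additive_subgroup.a_Hcarr ideal.axioms(1) primeideal.axioms(1))
    then have "I +> a \<notin> (+>) I ` Q i"
      using mem[of i a] i a by simp
    moreover have "I +> a \<in> (+>) I ` Q (Suc i)"
      using a(1) by (rule imageI)
    moreover have "(+>) I ` Q i \<subseteq> (+>) I ` Q (Suc i)"
      using chain[OF i] by (intro image_mono) blast
    ultimately show ?thesis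
      by (metis psubsetI)
  qed
  ultimately show ?thesis
    unfolding krull_dim_def
    by (intro Sup_upper CollectI exI[of _ k] exI[of _ "\<lambda>i. (+>) I ` Q i"] conjI refl allI impI)
qed

text \<open>The zero set of a single polynomial is closed. Hence the coordinate ring of the closure
  can be computed from the image itself.\<close>

lemma vanishing_ideal_zariski_closure: "vanishing_ideal (zariski_closure S) = vanishing_ideal S"
proof
  show "vanishing_ideal (zariski_closure S) \<subseteq> vanishing_ideal S"
    unfolding vanishing_ideal_def zariski_closure_def using hull_subset[of S zariski_closed] by blast
  show "vanishing_ideal S \<subseteq> vanishing_ideal (zariski_closure S)"
  proof
    fix f
    assume f: "f \<in> vanishing_ideal S"
    have "zariski_closed {A. \<forall>f\<in>{f}. entry_eval A f = 0}"
      unfolding zariski_closed_def by blast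
    moreover have "S \<subseteq> {A. \<forall>f\<in>{f}. entry_eval A f = 0}"
      using f by (auto simp: vanishing_ideal_def)
    ultimately have "zariski_closure S \<subseteq> {A. \<forall>f\<in>{f}. entry_eval A f = 0}"
      unfolding zariski_closure_def by (rule hull_minimal[rotated])
    then show "f \<in> vanishing_ideal (zariski_closure S)"
      by (auto simp: vanishing_ideal_def)
  qed
qed

lemma vanishing_ideal_antimono: "Z \<subseteq> Y \<Longrightarrow> vanishing_ideal Y \<subseteq> vanishing_ideal Z"
  by (auto simp: vanishing_ideal_def)

lemma vanishing_ideal_psubset:
  assumes "Z \<subseteq> Y" "\<And>A. A \<in> Z \<Longrightarrow> entry_eval A f = 0" "B \<in> Y" "entry_eval B f \<noteq> 0"
  shows "vanishing_ideal Y \<subset> vanishing_ideal Z"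
proof -
  have "f \<in> vanishing_ideal Z" "f \<notin> vanishing_ideal Y"
    using assms by (auto simp: vanishing_ideal_def)
  then show ?thesis
    using vanishing_ideal_antimono[OF assms(1)] by blast
qed

section \<open>The dimension of the image\<close>

lemma mpow_mscale: "mpow (mscale s A) e = mscale (s ^ e) (mpow A e)"
  by (induction e) (simp_all add: mscale_mult_left mscale_mult_right, simp add: vec_eq_iff mult_ac)

text \<open>The prescribed entries are those of the identity matrix, which therefore lies in every
  frame. The scalar is frozen at 1 and column \<open>o'\<close> is always fixed.\<close>

definition frames :: "'n \<Rightarrow> ('n \<times> 'n) set \<Rightarrow> ('k::field \<times> ('k^'n::finite^'n)) set" where
  "frames o' F = {(s, g). s = 1 \<and> (\<forall>b v. v = o' \<or> (b, v) \<in> F \<longrightarrow> g $ b $ v = (if b = v then 1 else 0))}"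

lemma frames_line_closed:
  "(s, g) \<in> frames o' F \<Longrightarrow> (t, h) \<in> frames o' F \<Longrightarrow> (s + r * (t - s), g + mscale r (h - g)) \<in> frames o' F"
  by (auto simp: frames_def)

text \<open>Both \<open>g\<close> and \<open>g'\<close> fix the basis vector at \<open>o'\<close>,
  so this column is \<open>g\<close> applied to column \<open>o'\<close> of the power of
  \<open>C\<close>, which is supported at \<open>v\<close> alone. Thus an entry of \<open>g\<close>
  can be read off polynomially from the conjugate.\<close>

lemma conj_mpow_column:
  fixes C :: "'k::field^'n::finite^'n"
  assumes C: "cyclic \<sigma> C" and v: "\<And>l. (\<sigma> ^^ e) l = o' \<longleftrightarrow> l = v"
    and g: "(s, g) \<in> frames o' F" "g ** g' = mat 1"
  shows "mpow (mscale s (g ** C ** g')) e $ b $ o' = g $ b $ v * mpow C e $ v $ o'"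
proof -
  have s: "s = 1" and col: "g $ l $ o' = (if l = o' then 1 else 0)" for l
    using g(1) by (auto simp: frames_def)
  have g'g: "g' ** g = mat 1"
    using g(2) by (rule matrix_left_right_inverse1)
  have "(g' ** g) $ i $ o' = g' $ i $ o'" for i
    unfolding matrix_matrix_mult_def vec_lambda_beta col
    using sum_delta_mult_right[of "\<lambda>l. g' $ i $ l" o' "\<lambda>_. 1"] by simp
  then have col': "g' $ l $ o' = (if l = o' then 1 else 0)" for l
    unfolding g'g by (simp add: mat_def)
  have "mpow (mscale s (g ** C ** g')) e $ b $ o' = (g ** mpow C e ** g') $ b $ o'"
    by (simp add: s mpow_conj[OF g'g g(2)])
  also have "\<dots> = (g ** mpow C e) $ b $ o'"
    unfolding matrix_matrix_mult_def[of _ g'] vec_lambda_beta col'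
    using sum_delta_mult_right[of "\<lambda>l. (g ** mpow C e) $ b $ l" o' "\<lambda>_. 1"] by simp
  finally have *: "mpow (mscale s (g ** C ** g')) e $ b $ o' = (g ** mpow C e) $ b $ o'" .
  have "mpow C e $ l $ o' = 0" if "l \<noteq> v" for l
    using cyclic_mpow[OF C, of e l o'] v[of l] that by metis
  then have "(g ** mpow C e) $ b $ o' = (\<Sum>l\<in>UNIV. g $ b $ l * (if l = v then mpow C e $ l $ o' else 0))"
    unfolding matrix_matrix_mult_def vec_lambda_beta
    by (intro sum.cong refl) auto
  with * show ?thesis
    by (simp only: sum_delta_mult_right)
qed

text \<open>Only the entry \<open>(b, v)\<close> of the identity is changed: by scaling on the
  diagonal, by a transvection off it.\<close>

lemma frames_refine:
  fixes v o' :: "'n::finite"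
  assumes inf: "infinite (UNIV :: 'k::field set)" and v: "v \<noteq> o'" "(b, v) \<notin> F"
  shows "\<exists>g g' :: 'k::field^'n^'n. (1, g) \<in> frames o' F \<and> g ** g' = mat 1 \<and> g $ b $ v \<noteq> (if b = v then 1 else 0)"
proof (cases "b = v")
  case True
  obtain z :: 'k where z: "z \<notin> {0, 1}"
    using inf by (metis ex_new_if_finite finite.emptyI finite_insert)
  let ?g = "diag (\<lambda>i. if i = v then z else 1) :: 'k^'n^'n"
    and ?g' = "diag (\<lambda>i. if i = v then inverse z else 1) :: 'k^'n^'n"
  have "?g ** ?g' = mat 1"
    using z by (auto simp: vec_eq_iff mult_diag_nth) (auto simp: diag_def mat_def)
  moreover have "(1, ?g) \<in> frames o' F"
    using v True by (auto simp: frames_def diag_def)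
  moreover have "?g $ b $ v \<noteq> (if b = v then 1 else 0)"
    using z True by (simp add: diag_def)
  ultimately show ?thesis
    by blast
next
  case False
  let ?g = "mat 1 + munit b v :: 'k^'n^'n"
  have "(1, ?g) \<in> frames o' F"
    using v by (auto simp: frames_def mat_def)
  moreover have "?g $ b $ v \<noteq> (if b = v then 1 else 0)"
    using False by (simp add: mat_def)
  ultimately show ?thesis
    using transvection(1)[OF False] by blast
qed

context equivariant
begin

text \<open>The scalar is absorbed into the first argument, whence \<open>m \<ge> 1\<close>; the
  conjugation goes into all arguments.\<close>

lemma conj_family_subset_range:
  assumes "m \<ge> 1"
  shows "conj_family (P z) H \<subseteq> range P"
proof
  fix A
  assume "A \<in> conj_family (P z) H"
  then obtain s g g' where A: "A = mscale s (g ** P z ** g')" "g ** g' = mat 1"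
    unfolding conj_family_def by blast
  have "P (z(1 := mscale s (z 1))) $ a $ b = s * P z $ a $ b" for a b
    using mlin_upd_scale[OF mlin, of 1 z s "z 1"] assms by simp
  then have *: "P (z(1 := mscale s (z 1))) = mscale s (P z)"
    unfolding vec_eq_iff by simp
  then have "A = P (\<lambda>k. g ** (z(1 := mscale s (z 1))) k ** g')"
    unfolding conj[OF A(2)] A(1) by (simp only: * mscale_mult_left mscale_mult_right)
  then show "A \<in> range P"
    by blast
qed

text \<open>With \<open>C\<close> a cyclic value, the columns of a conjugating matrix that fixes a basis vector are,
  up to scalars, the images of this vector under the powers of the conjugate of \<open>C\<close>.  Hence the
  conjugates of \<open>C\<close> contribute \<open>n\<^sup>2 - n\<close> to the dimension, scaling contributes 1, and the last 1
  comes from a value with a nonscalar \<open>n\<close>-th power.\<close>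

lemma variety_dim_image_ge:
  assumes n: "CARD('n) \<ge> 4" and ns: "\<not> (\<exists>c. P y = mat c)"
  shows "variety_dim (zariski_closure (range P)) \<ge> enat ((CARD('n))\<^sup>2 - CARD('n) + 2)"
proof -
  have m: "m \<ge> 1"
  proof (rule ccontr)
    assume "\<not> m \<ge> 1"
    then have "m = 0" by simp
    obtain y a b where ab: "a \<noteq> b" "P y $ a $ b \<noteq> 0"
      using scalar_if_offdiag_0[of y] ns by metis
    obtain I J where "P (units I J) $ a $ b \<noteq> 0"
      using mlin_nonzero_units[OF mlin ab(2)] by blast
    \<comment> \<open>With no variables the sums are empty, so the identity would force
      \<open>a\<close> and \<open>b\<close> to have equal weight; the indicator of \<open>a\<close>
      contradicts this.\<close>
    from units_weight[OF this, of "\<lambda>v. if v = a then 1 else 0"] show False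
      using ab(1) \<open>m = 0\<close> by simp
  qed
  have "CARD('n) \<ge> 3"
    using n by simp
  then obtain h \<sigma> z where h: "bij_betw h (UNIV :: 'n set) {..<CARD('n)}"
    and \<sigma>: "\<And>v. h (\<sigma> v) = Suc (h v) mod CARD('n)" and C: "cyclic \<sigma> (P z)"
    using ex_cyclic_value[OF _ ns] by blast
  define C where "C = P z"
  obtain c where c: "c \<noteq> 0" "mpow C CARD('n) = mat c"
    using cyclic_mpow_card[OF C h \<sigma>] unfolding C_def by blast
  have inj: "inj h" and lt: "h v < CARD('n)" for v
    using h by (auto simp: bij_betw_def)
  have pow: "h ((\<sigma> ^^ t) v) = (h v + t) mod CARD('n)" for t v
    by (rule funpow_shift[of h \<sigma>, OF \<sigma> lt])
  obtain o' where o': "h o' = 0"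
    using h by (metis UNIV_I bij_betw_def imageE lessThan_iff zero_less_card_finite)
  \<comment> \<open>The number of shifts that carry \<open>v\<close> to \<open>o'\<close>; for
    \<open>v = o'\<close> it is a full turn.\<close>
  define e where "e v = CARD('n) - h v" for v
  have e: "(\<sigma> ^^ e v) l = o' \<longleftrightarrow> l = v" for v l
  proof -
    have "(\<sigma> ^^ e v) l = o' \<longleftrightarrow> (h l + e v) mod CARD('n) = (h v + e v) mod CARD('n)"
      using inj_eq[OF inj, of "(\<sigma> ^^ e v) l" o'] lt[of v] by (simp add: pow o' e_def)
    also have "\<dots> \<longleftrightarrow> h l mod CARD('n) = h v mod CARD('n)"
      by (simp add: nat_mod_eq_iff)
    also have "\<dots> \<longleftrightarrow> l = v"
      using inj_eq[OF inj] by (simp add: lt)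
    finally show ?thesis .
  qed
  let ?pos = "UNIV \<times> (UNIV - {o'}) :: ('n \<times> 'n) set"
  obtain ps where ps: "set ps = ?pos" "distinct ps"
    using finite_distinct_list[of ?pos] by auto
  have len: "length ps = CARD('n) * (CARD('n) - 1)"
    using distinct_card[OF ps(2)] by (simp add: ps(1) card_cartesian_product)
  \<comment> \<open>The strict inclusions: one from the image to the scaled conjugates, one for
    freezing the scalar, and one for each entry outside column \<open>o'\<close>.\<close>
  define k where "k = Suc (Suc (length ps))"
  define Z where "Z i = (if i = 0 then range P else if i = 1 then conj_family C UNIV
    else conj_family C (frames o' (set (take (i - 2) ps))))" for i
  have Z_Suc: "Z (Suc (Suc j)) = conj_family C (frames o' (set (take j ps)))" for j
    by (simp add: Z_def)
  have sub0: "Z i \<subseteq> Z 0" for i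
    using conj_family_subset_range[OF m] by (auto simp: Z_def C_def)
  have "conj_family C H \<noteq> {}" if "(1, mat 1) \<in> H" for H
  proof -
    have "mscale 1 (mat 1 ** C ** mat 1) \<in> conj_family C H"
      unfolding conj_family_def using that matrix_mul_lid[of "mat 1"] by blast
    then show ?thesis by blast
  qed
  moreover have "(1, mat 1 :: 'k^'n^'n) \<in> frames o' F" for F :: "('n \<times> 'n) set"
    by (simp add: frames_def mat_def)
  ultimately have "Z i \<noteq> {}" for i
    by (simp add: Z_def)
  moreover have "rat_connected (Z i)" for i
    unfolding Z_def using mlin_line_poly[OF mlin]
    by (auto intro!: rat_connected_image rat_connected_conj_family frames_line_closed)
  ultimately have prime: "primeideal (vanishing_ideal (Z i)) ring_of_type_algebra" for i
    by (intro primeideal_vanishing_ideal inf)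
  have chain: "vanishing_ideal (Z i) \<subset> vanishing_ideal (Z (Suc i))" if "i < k" for i
  proof -
    let ?X = "mpow generic_matrix CARD('n)"
    have Zpow: "mpow (mscale s (g ** C ** g')) CARD('n) = mat (s ^ CARD('n) * c)"
      if "g ** g' = mat 1" for s and g g' :: "'k^'n^'n"
    proof -
      have "g' ** g = mat 1"
        using that by (rule matrix_left_right_inverse1)
      from mpow_conj[OF this that] have "mpow (g ** C ** g') CARD('n) = mat c"
        by (simp add: c(2) mat_mult mscale_mult_left mscale_mult_right that flip: matrix_mul_assoc)
          (simp add: vec_eq_iff mat_def)
      then show ?thesis
        by (simp add: mpow_mscale vec_eq_iff mat_def)
    qed
    consider "i = 0" | "i = 1" | j where "i = Suc (Suc j)"
      by (metis One_nat_def not0_implies_Suc)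
    then show ?thesis
    proof cases
      case 1
      \<comment> \<open>The first part of the argument provides a value with nonscalar power. An
        off-diagonal entry of the power, or a difference of two diagonal ones, then separates it
        from the scaled conjugates.\<close>
      obtain y where y: "\<not> (\<exists>c. mpow (P y) CARD('n) = mat c)"
        using power_scalar_imp_scalar[OF n, of "CARD('n)"] ns n by fastforce
      have "\<exists>f. entry_eval (P y) f \<noteq> 0 \<and> (\<forall>A\<in>Z 1. entry_eval A f = 0)"
      proof (cases "\<exists>a b. a \<noteq> b \<and> mpow (P y) CARD('n) $ a $ b \<noteq> 0")
        case True
        then obtain a b where ab: "a \<noteq> b" "mpow (P y) CARD('n) $ a $ b \<noteq> 0"
          by blast
        then have "entry_eval (P y) (?X $ a $ b) \<noteq> 0" "\<forall>A\<in>Z 1. entry_eval A (?X $ a $ b) = 0"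
          by (auto simp: entry_eval_mpow Z_def conj_family_def Zpow mat_def)
        then show ?thesis by blast
      next
        case False
        have "\<exists>a b. mpow (P y) CARD('n) $ a $ a \<noteq> mpow (P y) CARD('n) $ b $ b"
        proof (rule ccontr)
          assume "\<not> ?thesis"
          then have "mpow (P y) CARD('n) $ a $ b = mat (mpow (P y) CARD('n) $ o' $ o') $ a $ b" for a b
            using False by (cases "a = b") (auto simp: mat_def)
          then have "mpow (P y) CARD('n) = mat (mpow (P y) CARD('n) $ o' $ o')"
            unfolding vec_eq_iff by blast
          then show False
            using y by blast
        qed
        then obtain a b where "mpow (P y) CARD('n) $ a $ a \<noteq> mpow (P y) CARD('n) $ b $ b"
          by blast
        then have "entry_eval (P y) (?X $ a $ a - ?X $ b $ b) \<noteq> 0"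
          "\<forall>A\<in>Z 1. entry_eval A (?X $ a $ a - ?X $ b $ b) = 0"
          by (auto simp: entry_eval_mpow entry_eval_diff Z_def conj_family_def Zpow mat_def)
        then show ?thesis by blast
      qed
      then obtain f where f: "entry_eval (P y) f \<noteq> 0" "\<forall>A\<in>Z 1. entry_eval A f = 0"
        by blast
      have "vanishing_ideal (Z 0) \<subset> vanishing_ideal (Z 1)"
      proof (rule vanishing_ideal_psubset[OF sub0 _ _ f(1)])
        show "P y \<in> Z 0"
          by (simp add: Z_def)
      qed (use f(2) in blast)
      then show ?thesis
        by (simp only: 1 One_nat_def)
    next
      case 2
      \<comment> \<open>Vanishes on conjugates with scalar 1, but not at the zero matrix, which
        arises from the scalar 0.\<close>
      let ?f = "?X $ o' $ o' - Poly_Mapping.single 0 c"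
      have "mscale 0 (mat 1 ** C ** mat 1) \<in> conj_family C UNIV"
        unfolding conj_family_def using matrix_mul_lid[of "mat 1"] by blast
      then have "0 \<in> Z 1"
        by (simp add: Z_def)
      moreover have "entry_eval 0 ?f \<noteq> 0"
      proof -
        have "mpow (0 :: 'k^'n^'n) CARD('n) = mat (0 ^ CARD('n) * c)"
          using Zpow[OF matrix_mul_lid[of "mat 1"], of 0] by (simp only: mscale_0)
        then have "mpow (0 :: 'k^'n^'n) CARD('n) $ o' $ o' = 0"
          by (simp add: mat_def)
        then show ?thesis
          using c(1) by (simp add: entry_eval_diff entry_eval_mpow entry_eval_const)
      qed
      moreover have "entry_eval A ?f = 0" if "A \<in> Z (Suc (Suc 0))" for A
        using that unfolding Z_Suc
        by (auto simp: conj_family_def frames_def entry_eval_diff entry_eval_mpow entry_eval_const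
            Zpow[of _ _ 1, simplified] mat_def)
      moreover have "Z (Suc (Suc 0)) \<subseteq> Z 1"
        by (auto simp: Z_def conj_family_def)
      ultimately show ?thesis
        unfolding 2 One_nat_def by (intro vanishing_ideal_psubset)
    next
      case (3 j)
      then have j: "j < length ps"
        using \<open>i < k\<close> by (simp add: k_def)
      obtain b v where bv: "ps ! j = (b, v)"
        by fastforce
      have v: "v \<noteq> o'"
        using nth_mem[OF j] ps(1) bv by auto
      have "distinct (take j ps @ ps ! j # drop (Suc j) ps)"
        unfolding id_take_nth_drop[OF j, symmetric] by (rule ps(2))
      then have notin: "(b, v) \<notin> set (take j ps)"
        by (simp add: bv)
      let ?F = "set (take j ps)"
      have take: "set (take (Suc j) ps) = insert (b, v) ?F"
        using j bv by (simp add: take_Suc_conv_app_nth)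
      define \<pi> where "\<pi> = mpow C (e v) $ v $ o'"
      have \<pi>: "\<pi> \<noteq> 0"
        unfolding \<pi>_def using cyclic_mpow[OF C, of "e v" v o'] e[of v v] by (simp add: C_def)
      \<comment> \<open>By \<open>conj_mpow_column\<close> this is \<open>\<pi>\<close> times the
        deviation of the entry \<open>(b, v)\<close> of \<open>g\<close> from the identity
        matrix.\<close>
      let ?f = "mpow generic_matrix (e v) $ b $ o' - Poly_Mapping.single 0 ((if b = v then 1 else 0) * \<pi>)"
      have f: "entry_eval (mscale s (g ** C ** g')) ?f = (g $ b $ v - (if b = v then 1 else 0)) * \<pi>"
        if "(s, g) \<in> frames o' F" "g ** g' = mat 1" for s g g' F
        using conj_mpow_column[OF C[folded C_def] e that, of v b]
        by (simp add: entry_eval_diff entry_eval_mpow entry_eval_const \<pi>_def left_diff_distrib)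
      obtain g g' :: "'k^'n^'n" where g: "(1, g) \<in> frames o' ?F" "g ** g' = mat 1"
        "g $ b $ v \<noteq> (if b = v then 1 else 0)"
        using frames_refine[OF inf v notin] by blast
      show ?thesis
        unfolding 3 Z_Suc
      proof (rule vanishing_ideal_psubset)
        show "conj_family C (frames o' (set (take (Suc j) ps))) \<subseteq> conj_family C (frames o' ?F)"
          unfolding take conj_family_def frames_def by blast
        show "entry_eval A ?f = 0" if A: "A \<in> conj_family C (frames o' (set (take (Suc j) ps)))" for A
        proof -
          obtain s g g' where sg: "A = mscale s (g ** C ** g')" "(s, g) \<in> frames o' (insert (b, v) ?F)"
            "g ** g' = mat 1"
            using A unfolding take conj_family_def by blast
          then show ?thesis
            using f[OF sg(2,3)] by (simp add: frames_def)
        qed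
        show "mscale 1 (g ** C ** g') \<in> conj_family C (frames o' ?F)"
          unfolding conj_family_def using g by blast
        show "entry_eval (mscale 1 (g ** C ** g')) ?f \<noteq> 0"
          using f[OF g(1,2)] g(3) \<pi> by simp
      qed
    qed
  qed
  have "(ring_of_type_algebra :: ('n, 'k) entry_poly ring) Quot vanishing_ideal (zariski_closure (range P))
      = ring_of_type_algebra Quot vanishing_ideal (Z 0)"
    by (simp add: vanishing_ideal_zariski_closure Z_def)
  moreover have "krull_dim ((ring_of_type_algebra :: ('n, 'k) entry_poly ring) Quot vanishing_ideal (Z 0))
      \<ge> enat k"
    by (rule krull_dim_quot_ge[of _ _ _ "\<lambda>i. vanishing_ideal (Z i)"])
      (use prime chain vanishing_ideal_antimono[OF sub0] in
        \<open>auto intro: ideal_vanishing_ideal cring_from_type_algebra\<close>)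
  moreover have "k = (CARD('n))\<^sup>2 - CARD('n) + 2"
    by (simp add: k_def len power2_eq_square diff_mult_distrib2)
  ultimately show ?thesis
    unfolding variety_dim_def by simp
qed

end

section \<open>Specialisation to the evaluation map of a multilinear polynomial\<close>

theorem theorem5:
  assumes "infinite (UNIV :: 'k::field set)"
    and "CARD('n::finite) \<ge> 4"
  shows "\<not> (\<exists>m. \<exists>p :: (nat, 'k) free_algebra. multilinear m p \<and> power_central TYPE('n) p)
    \<and> (\<forall>m. \<forall>p :: (nat, 'k) free_algebra. multilinear m p \<longrightarrow>
         PI_poly TYPE('n) p \<or> central_poly TYPE('n) p
         \<or> image_dim TYPE('n) p \<ge> enat (CARD('n)\<^sup>2 - CARD('n) + 2))"
proof (intro conjI allI impI notI)
  assume "\<exists>m. \<exists>p :: (nat, 'k) free_algebra. multilinear m p \<and> power_central TYPE('n) p"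
  \<comment> \<open>Minimality of \<open>\<nu> > 1\<close>, applied to the exponent 1, says that
    \<open>p\<close> itself is not central.\<close>
  then obtain m \<nu> and p :: "(nat, 'k) free_algebra" where p: "multilinear m p"
    and \<nu>: "\<nu> > 1" "central_poly TYPE('n) (p ^ \<nu>)" "\<not> central_poly TYPE('n) (p ^ 1)"
    unfolding power_central_def nu_central_def by (metis le_refl)
  interpret equivariant "\<lambda>y. nc_eval y p :: 'k^'n^'n" m
    by (rule multilinear_equivariant[OF p assms(1)])
  have "\<exists>c. nc_eval y p = mat c" for y :: "nat \<Rightarrow> 'k^'n^'n"
    by (rule power_scalar_imp_scalar[OF assms(2), of \<nu>])
      (use \<nu> in \<open>auto simp: central_poly_def nc_eval_power\<close>)
  then have "PI_poly TYPE('n) p"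
    using \<nu>(3) by (simp add: central_poly_def)
  \<comment> \<open>A positive power of \<open>p\<close> has \<open>p\<close> as a factor, so it
    vanishes with \<open>p\<close> and cannot be central.\<close>
  then have "PI_poly TYPE('n) (p ^ \<nu>)"
    using \<nu>(1) by (cases \<nu>) (auto simp: PI_poly_def nc_eval_mult)
  then show False
    using \<nu>(2) by (simp add: central_poly_def)
next
  fix m and p :: "(nat, 'k) free_algebra"
  assume p: "multilinear m p"
  interpret equivariant "\<lambda>y. nc_eval y p :: 'k^'n^'n" m
    by (rule multilinear_equivariant[OF p assms(1)])
  have "range (\<lambda>y. nc_eval y p :: 'k^'n^'n) = poly_image p"
    by (auto simp: poly_image_def)
  then show "PI_poly TYPE('n) p \<or> central_poly TYPE('n) p
      \<or> image_dim TYPE('n) p \<ge> enat (CARD('n)\<^sup>2 - CARD('n) + 2)"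
    using variety_dim_image_ge[OF assms(2)] unfolding central_poly_def image_dim_def by metis
qed

end
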